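(* Let $\Sigma$ be a finite alphabet. The computational problem $\texttt{SHAP}(\texttt{WA},\texttt{MARKOV})$ is in FP. That is, there is an algorithm which, given a weighted automaton $A$ over $\Sigma^*$, a sequence $w\in\Sigma^*$, an integer $i\in[|w|]$ and a polynomial-time computable Markovian distribution $P\in\texttt{MARKOV}$ over $\Sigma^\infty$, computes exactly the number $\mathrm{SHAP}(A,w,i,P)$ in time $O(\mathrm{poly}(\mathrm{size}(A),|w|,|\Sigma|))$.
   Context: Notation: $[n]=\{1,\dots,n\}$. For a finite alphabet $\Sigma$, $\Sigma^*$ (resp. $\Sigma^\infty$) is the set of finite (resp. infinite) sequences over $\Sigma$; $|w|$ is the length of $w$ and $w_j$ its $j$-th symbol. A language over $\Sigma^*$ is a function $\Sigma^*\to\mathbb{R}$. Weighted automata: a weighted automaton (WA) $A$ over $\Sigma^*$ of size $\mathrm{size}(A)=n$ is a tuple $\langle\alpha,\{A_\sigma\}_{\sigma\in\Sigma},\beta\rangle$ with $\alpha,\beta\in\mathbb{R}^n$, $A_\sigma\in\mathbb{R}^{n\times n}$. It computes the language $f_A(w)=\alpha^T A_{w_1}\cdots A_{w_{|w|}}\beta$. Markovian distributions: a Markovian distribution $P$ over $\Sigma^\infty$ is given by a probability distribution $P_{init}$ on $\Sigma$ and stochastic $|\Sigma|\times|\Sigma|$ matrices $P_n$, $n\ge1$ (rows sum to 1). All entries of $P_{init}$ and of all $P_n$ are assumed to be $>0$. It induces on $\Sigma^n$ the distribution $P^{(n)}(w)=P_{init}(w_1)\prod_{j=1}^{n-1}P_j[w_j,w_{j+1}]$.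 $\texttt{MARKOV}$ is the set of such $P$ that are polynomial-time computable: there is a procedure which on input $n>0$ outputs $P_n$ in time $O(\mathrm{poly}(n,|\Sigma|))$. As part of a problem instance, $P$ is given by $P_{init}$ and a machine implementing this procedure. Patterns: a pattern is a sequence $p$ over $\Sigma_\#=\Sigma\cup\{\#\}$, with $\#\notin\Sigma$ standing for "any symbol of $\Sigma$". Its language is $L_p=\{u\in\Sigma^{|p|}: \forall j,\ p_j=\#\text{ or }u_j=p_j\}$, and $|p|_\#$ is the number of occurrences of $\#$ in $p$. For $w\in\Sigma^*$ and $k\in[|w|]$, let $\mathcal{L}_k^w=\{p\in\Sigma_\#^{|w|}: w\in L_p,\ |p|_\#=k\}$ and let $\mathcal{P}_k^w$ be the uniform distribution on $\mathcal{L}_k^w$. $\mathrm{swap}(p,i)$ is the pattern obtained from $p$ by replacing its $i$-th symbol by $\#$. SHAP score: for a model $M$ computing a language $f_M$ over $\Sigma^*$, $$\mathrm{SHAP}(M,w,i,P)=\sum_{k=1}^{|w|-1}\frac{1}{|w|-k}\,\mathbb{E}_{p\sim\mathcal{P}^w_{|w|-k}}\big[V(p;M,w,P)-V(\mathrm{swap}(p,i);M,w,P)\big],$$ where $V(p;M,w,P)=\mathbb{E}_{w'\sim P^{(|w|)}}[f_M(w')\mid w'\in L_p]$. FP: a function problem is in FP if it can be computed exactly by an algorithm running in time polynomial in the size of the instance; here the instance size is measured by $\mathrm{size}(A)$, $|w|$, $|\Sigma|$. Running time counts elementary operations, including arithmetic operations on the (real) weights. *)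

theory Defs
  imports "HOL-Probability.Probability" "Jordan_Normal_Form.Matrix"
begin

section \<open>Weighted automata, Markovian distributions, SHAP score\<close>

text \<open>Lists are indexed from 0, so the $j$-th symbol $w_j$ is \<open>w ! (j - 1)\<close>.\<close>

record 'a wa =
  wa_size :: nat
  wa_alpha :: "real Matrix.vec"
  wa_mat :: "'a \<Rightarrow> real Matrix.mat"
  wa_beta :: "real Matrix.vec"

definition weighted_automaton :: "'a set \<Rightarrow> 'a wa \<Rightarrow> bool" where
  "weighted_automaton \<Sigma> A \<longleftrightarrow>
     wa_alpha A \<in> carrier_vec (wa_size A) \<and>
     (\<forall>\<sigma>\<in>\<Sigma>. wa_mat A \<sigma> \<in> carrier_mat (wa_size A) (wa_size A)) \<and>
     wa_beta A \<in> carrier_vec (wa_size A)"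

definition wa_lang :: "'a wa \<Rightarrow> 'a list \<Rightarrow> real" where
  "wa_lang A w =
     scalar_prod (wa_alpha A)
       (foldr (\<lambda>\<sigma> M. wa_mat A \<sigma> * M) w (1\<^sub>m (wa_size A)) *\<^sub>v wa_beta A)"

definition words :: "'a set \<Rightarrow> nat \<Rightarrow> 'a list set" where
  "words \<Sigma> n = {u. set u \<subseteq> \<Sigma> \<and> length u = n}"

text \<open>\<open>mk_trans P n\<close> is the matrix $P_n$; only the indices \<open>n \<ge> 1\<close> matter.\<close>

record 'a markov =
  mk_init :: "'a \<Rightarrow> real"
  mk_trans :: "nat \<Rightarrow> 'a \<Rightarrow> 'a \<Rightarrow> real"

definition markovian :: "'a set \<Rightarrow> 'a markov \<Rightarrow> bool" where
  "markovian \<Sigma> P \<longleftrightarrow>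
     (\<forall>a\<in>\<Sigma>. mk_init P a > 0) \<and> (\<Sum>a\<in>\<Sigma>. mk_init P a) = 1 \<and>
     (\<forall>n\<ge>1. \<forall>a\<in>\<Sigma>. (\<forall>b\<in>\<Sigma>. mk_trans P n a b > 0) \<and> (\<Sum>b\<in>\<Sigma>. mk_trans P n a b) = 1)"

definition markov_weight :: "'a markov \<Rightarrow> 'a list \<Rightarrow> real" where
  "markov_weight P u =
     mk_init P (u ! 0) * (\<Prod>j=1..length u - 1. mk_trans P j (u ! (j - 1)) (u ! j))"

definition markov_pmf :: "'a set \<Rightarrow> 'a markov \<Rightarrow> nat \<Rightarrow> 'a list pmf" where
  "markov_pmf \<Sigma> P n = embed_pmf (\<lambda>u. if u \<in> words \<Sigma> n then markov_weight P u else 0)"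

text \<open>A pattern is a list over \<open>'a option\<close>; \<open>None\<close> is the wildcard $\#$.\<close>

definition pattern_lang :: "'a set \<Rightarrow> 'a option list \<Rightarrow> 'a list set" where
  "pattern_lang \<Sigma> p = {u \<in> words \<Sigma> (length p). \<forall>j<length p. p ! j = None \<or> p ! j = Some (u ! j)}"

definition patterns :: "'a set \<Rightarrow> 'a list \<Rightarrow> nat \<Rightarrow> 'a option list set" where
  "patterns \<Sigma> w k =
     {p. set p \<subseteq> insert None (Some ` \<Sigma>) \<and> length p = length w \<and>
         w \<in> pattern_lang \<Sigma> p \<and> count_list p None = k}"

definition swap :: "'a option list \<Rightarrow> nat \<Rightarrow> 'a option list" where
  "swap p i = p[i - 1 := None]"

definition pattern_value ::
  "'a set \<Rightarrow> 'a option list \<Rightarrow> ('a list \<Rightarrow> real) \<Rightarrow> 'a list \<Rightarrow> 'a markov \<Rightarrow> real" where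
  "pattern_value \<Sigma> p f w P =
     measure_pmf.expectation (cond_pmf (markov_pmf \<Sigma> P (length w)) (pattern_lang \<Sigma> p)) f"

definition shap :: "'a set \<Rightarrow> ('a list \<Rightarrow> real) \<Rightarrow> 'a list \<Rightarrow> nat \<Rightarrow> 'a markov \<Rightarrow> real" where
  "shap \<Sigma> f w i P =
     (\<Sum>k=1..length w - 1. 1 / real (length w - k) *
        measure_pmf.expectation (pmf_of_set (patterns \<Sigma> w (length w - k)))
          (\<lambda>p. pattern_value \<Sigma> p f w P - pattern_value \<Sigma> (swap p i) f w P))"

lemma words_Suc_snoc: "words \<Sigma> (Suc n) = (\<lambda>(u, b). u @ [b]) ` (words \<Sigma> n \<times> \<Sigma>)"
proof (intro Set.set_eqI iffI)
  fix v assume v: "v \<in> words \<Sigma> (Suc n)"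
  then obtain u b where "v = u @ [b]"
    by (cases v rule: rev_cases) (auto simp: words_def)
  with v show "v \<in> (\<lambda>(u, b). u @ [b]) ` (words \<Sigma> n \<times> \<Sigma>)"
    by (auto simp: words_def image_iff)
qed (auto simp: words_def)

lemma markov_weight_snoc:
  assumes "u \<noteq> []"
  shows "markov_weight P (u @ [b]) = markov_weight P u * mk_trans P (length u) (last u) b"
proof -
  obtain n where n: "length u = Suc n" using assms by (cases u) auto
  have "(\<Prod>j=1..n. mk_trans P j ((u @ [b]) ! (j - 1)) ((u @ [b]) ! j)) =
        (\<Prod>j=1..n. mk_trans P j (u ! (j - 1)) (u ! j))"
    by (intro prod.cong) (auto simp: nth_append n)
  then show ?thesis
    using assms n by (simp add: markov_weight_def nth_append last_conv_nth)
qed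

lemma sum_markov_weight:
  assumes "markovian \<Sigma> P"
  shows "(\<Sum>u\<in>words \<Sigma> (Suc n). markov_weight P u) = 1"
proof (induction n)
  case 0
  have "words \<Sigma> (Suc 0) = (\<lambda>a. [a]) ` \<Sigma>"
    by (auto simp: words_def length_Suc_conv)
  then show ?case
    using assms by (simp add: sum.reindex inj_on_def markov_weight_def markovian_def)
next
  case (Suc n)
  have inj: "inj_on (\<lambda>(u, b). u @ [b]) (words \<Sigma> (Suc n) \<times> \<Sigma>)"
    by (auto simp: inj_on_def)
  have row: "(\<Sum>b\<in>\<Sigma>. markov_weight P (u @ [b])) = markov_weight P u"
    if "u \<in> words \<Sigma> (Suc n)" for u
  proof -
    from that have u: "u \<noteq> []" "length u = Suc n" "set u \<subseteq> \<Sigma>"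
      by (auto simp: words_def)
    moreover from u have "last u \<in> \<Sigma>"
      using last_in_set by blast
    ultimately show ?thesis
      using assms by (simp add: markov_weight_snoc sum_distrib_left[symmetric] markovian_def)
  qed
  have "(\<Sum>v\<in>words \<Sigma> (Suc (Suc n)). markov_weight P v) =
        (\<Sum>u\<in>words \<Sigma> (Suc n). \<Sum>b\<in>\<Sigma>. markov_weight P (u @ [b]))"
    unfolding words_Suc_snoc[of \<Sigma> "Suc n"] sum.reindex[OF inj]
    by (simp add: sum.cartesian_product case_prod_beta)
  also have "\<dots> = 1"
    using Suc.IH row by simp
  finally show ?case .
qed

lemma markov_weight_pos:
  assumes "markovian \<Sigma> P" "u \<in> words \<Sigma> (Suc n)"
  shows "markov_weight P u > 0"
  using assms
  by (auto simp: markov_weight_def markovian_def words_def subset_iff intro!: mult_pos_pos prod_pos)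

text \<open>The argument of \<open>embed_pmf\<close> in \<open>markov_pmf\<close> is a probability mass function
  for every positive length.\<close>

lemma pmf_markov_pmf:
  assumes "markovian \<Sigma> P" "finite \<Sigma>" "n \<ge> 1"
  shows "pmf (markov_pmf \<Sigma> P n) u = (if u \<in> words \<Sigma> n then markov_weight P u else 0)"
proof -
  obtain k where k: "n = Suc k" using assms(3) by (cases n) auto
  have fin: "finite (words \<Sigma> n)"
    using finite_lists_length_eq[OF assms(2), of n] by (simp add: words_def)
  have nonneg: "0 \<le> (if v \<in> words \<Sigma> n then markov_weight P v else 0)" for v
    using markov_weight_pos[OF assms(1)] by (simp add: k less_imp_le)
  have "(\<integral>\<^sup>+v. ennreal (if v \<in> words \<Sigma> n then markov_weight P v else 0) \<partial>count_space UNIV) =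
        (\<Sum>v\<in>words \<Sigma> n. ennreal (if v \<in> words \<Sigma> n then markov_weight P v else 0))"
    using fin by (intro nn_integral_count_space') auto
  also have "\<dots> = ennreal (\<Sum>v\<in>words \<Sigma> n. if v \<in> words \<Sigma> n then markov_weight P v else 0)"
    by (intro sum_ennreal nonneg)
  also have "\<dots> = 1"
    using sum_markov_weight[OF assms(1)] by (simp add: k)
  finally show ?thesis
    unfolding markov_pmf_def by (intro pmf_embed_pmf nonneg)
qed

section \<open>The machine model: a real RAM\<close>

text \<open>
  Algorithms are programs of a While language over two memories, one of natural numbers and one
  of reals, both organised in named arrays.  An array is indexed by lists of naturals, so that
  a scalar is a cell with index \<open>[]\<close> and a matrix entry a cell with index \<open>[a, b]\<close>; since
  index lists are written out in the program text, every program uses finitely many arrays of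
  fixed dimensions.

  The field operations and comparisons on reals have unit cost.  Naturals serve for counting and
  indexing only: they have addition and truncated subtraction but no multiplication, so that within
  $t$ steps only numbers of $O(t)$ bits arise and unit cost is reasonable.  There is no way to
  round a real to a natural.

  A program may contain calls to one external procedure, which takes a natural number and returns
  an array of reals.
\<close>

record state =
  nmem :: "string \<Rightarrow> nat list \<Rightarrow> nat"
  rmem :: "string \<Rightarrow> nat list \<Rightarrow> real"

datatype nexp =
    NConst nat
  | NCell string "nexp list"
  | NAdd nexp nexp
  | NSub nexp nexp

datatype rexp =
    RConst real
  | RCell string "nexp list"
  | RAdd rexp rexp
  | RSub rexp rexp
  | RMul rexp rexp
  | RDiv rexp rexp

datatype bexp =
    NEq nexp nexp
  | NLess nexp nexp
  | REq rexp rexp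
  | RLess rexp rexp
  | Not bexp
  | And bexp bexp

datatype com =
    Skip
  | NAssign string "nexp list" nexp
  | RAssign string "nexp list" rexp
  | Seq com com
  | If bexp com com
  | While bexp com
  | Call string nexp

primrec neval :: "nexp \<Rightarrow> state \<Rightarrow> nat" where
  "neval (NConst k) s = k"
| "neval (NCell x es) s = nmem s x (map (\<lambda>e. neval e s) es)"
| "neval (NAdd e f) s = neval e s + neval f s"
| "neval (NSub e f) s = neval e s - neval f s"

primrec reval :: "rexp \<Rightarrow> state \<Rightarrow> real" where
  "reval (RConst c) s = c"
| "reval (RCell x es) s = rmem s x (map (\<lambda>e. neval e s) es)"
| "reval (RAdd e f) s = reval e s + reval f s"
| "reval (RSub e f) s = reval e s - reval f s"
| "reval (RMul e f) s = reval e s * reval f s"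
| "reval (RDiv e f) s = reval e s / reval f s"

primrec beval :: "bexp \<Rightarrow> state \<Rightarrow> bool" where
  "beval (NEq e f) s \<longleftrightarrow> neval e s = neval f s"
| "beval (NLess e f) s \<longleftrightarrow> neval e s < neval f s"
| "beval (REq e f) s \<longleftrightarrow> reval e s = reval f s"
| "beval (RLess e f) s \<longleftrightarrow> reval e s < reval f s"
| "beval (Not b) s \<longleftrightarrow> \<not> beval b s"
| "beval (And b c) s \<longleftrightarrow> beval b s \<and> beval c s"

text \<open>The cost of evaluating an expression is the number of its operations and memory accesses,
  those in index expressions included.\<close>

primrec ncost :: "nexp \<Rightarrow> nat" where
  "ncost (NConst k) = 1"
| "ncost (NCell x es) = 1 + sum_list (map ncost es)"
| "ncost (NAdd e f) = 1 + ncost e + ncost f"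
| "ncost (NSub e f) = 1 + ncost e + ncost f"

primrec rcost :: "rexp \<Rightarrow> nat" where
  "rcost (RConst c) = 1"
| "rcost (RCell x es) = 1 + sum_list (map ncost es)"
| "rcost (RAdd e f) = 1 + rcost e + rcost f"
| "rcost (RSub e f) = 1 + rcost e + rcost f"
| "rcost (RMul e f) = 1 + rcost e + rcost f"
| "rcost (RDiv e f) = 1 + rcost e + rcost f"

primrec bcost :: "bexp \<Rightarrow> nat" where
  "bcost (NEq e f) = 1 + ncost e + ncost f"
| "bcost (NLess e f) = 1 + ncost e + ncost f"
| "bcost (REq e f) = 1 + rcost e + rcost f"
| "bcost (RLess e f) = 1 + rcost e + rcost f"
| "bcost (Not b) = 1 + bcost b"
| "bcost (And b c) = 1 + bcost b + bcost c"

definition nupdate :: "string \<Rightarrow> nat list \<Rightarrow> nat \<Rightarrow> state \<Rightarrow> state" where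
  "nupdate x js v s = s\<lparr>nmem := (nmem s)(x := (nmem s x)(js := v))\<rparr>"

definition rupdate :: "string \<Rightarrow> nat list \<Rightarrow> real \<Rightarrow> state \<Rightarrow> state" where
  "rupdate x js v s = s\<lparr>rmem := (rmem s)(x := (rmem s x)(js := v))\<rparr>"

text \<open>
  \<open>exec proc c s t s'\<close>: started in \<open>s\<close>, the program \<open>c\<close> halts in \<open>s'\<close> after time \<open>t\<close>.  Here
  \<open>proc k t a\<close> says that the external procedure, called on \<open>k\<close>, returns the array \<open>a\<close> after
  time \<open>t\<close>; the caller is charged this time in full.
\<close>

inductive exec ::
  "(nat \<Rightarrow> nat \<Rightarrow> (nat list \<Rightarrow> real) \<Rightarrow> bool) \<Rightarrow> com \<Rightarrow> state \<Rightarrow> nat \<Rightarrow> state \<Rightarrow> bool"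
  for proc where
  Skip: "exec proc Skip s 1 s"
| NAssign: "exec proc (NAssign x es e) s (1 + sum_list (map ncost es) + ncost e)
     (nupdate x (map (\<lambda>e. neval e s) es) (neval e s) s)"
| RAssign: "exec proc (RAssign x es e) s (1 + sum_list (map ncost es) + rcost e)
     (rupdate x (map (\<lambda>e. neval e s) es) (reval e s) s)"
| Seq: "exec proc c1 s t1 s' \<Longrightarrow> exec proc c2 s' t2 s'' \<Longrightarrow>
     exec proc (Seq c1 c2) s (t1 + t2) s''"
| IfTrue: "beval b s \<Longrightarrow> exec proc c1 s t s' \<Longrightarrow> exec proc (If b c1 c2) s (1 + bcost b + t) s'"
| IfFalse: "\<not> beval b s \<Longrightarrow> exec proc c2 s t s' \<Longrightarrow> exec proc (If b c1 c2) s (1 + bcost b + t) s'"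
| WhileFalse: "\<not> beval b s \<Longrightarrow> exec proc (While b c) s (1 + bcost b) s"
| WhileTrue: "beval b s \<Longrightarrow> exec proc c s t1 s' \<Longrightarrow> exec proc (While b c) s' t2 s'' \<Longrightarrow>
     exec proc (While b c) s (1 + bcost b + t1 + t2) s''"
| Call: "proc (neval e s) t a \<Longrightarrow>
     exec proc (Call x e) s (1 + ncost e + t) (s\<lparr>rmem := (rmem s)(x := a)\<rparr>)"

inductive_cases exec_SkipE: "exec proc Skip s t s'"
inductive_cases exec_NAssignE: "exec proc (NAssign x es e) s t s'"
inductive_cases exec_RAssignE: "exec proc (RAssign x es e) s t s'"
inductive_cases exec_SeqE: "exec proc (Seq c1 c2) s t s'"
inductive_cases exec_IfE: "exec proc (If b c1 c2) s t s'"
inductive_cases exec_WhileE: "exec proc (While b c) s t s'"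
inductive_cases exec_CallE: "exec proc (Call x e) s t s'"

lemma exec_deterministic:
  assumes det: "\<And>k t t' a a'. proc k t a \<Longrightarrow> proc k t' a' \<Longrightarrow> t' = t \<and> a' = a"
    and "exec proc c s t s'" "exec proc c s u v"
  shows "u = t \<and> v = s'"
  using assms(2,3)
proof (induction arbitrary: u v rule: exec.induct)
  case (Skip s)
  then show ?case by (elim exec_SkipE) simp
next
  case (NAssign x es e s)
  then show ?case by (elim exec_NAssignE) simp
next
  case (RAssign x es e s)
  then show ?case by (elim exec_RAssignE) simp
next
  case (Seq c1 s t1 s' c2 t2 s'')
  from Seq.prems obtain u1 r u2 where
    r: "u = u1 + u2" "exec proc c1 s u1 r" "exec proc c2 r u2 v"
    by (rule exec_SeqE)
  from Seq.IH(1)[OF r(2)] have "u1 = t1" "r = s'" by simp_all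
  with r Seq.IH(2)[of u2 v] show ?case by simp
next
  case (IfTrue b s c1 t s' c2)
  from IfTrue.prems IfTrue.hyps(1) obtain u' where
    "u = 1 + bcost b + u'" "exec proc c1 s u' v"
    by (elim exec_IfE) auto
  with IfTrue.IH[of u' v] show ?case by simp
next
  case (IfFalse b s c2 t s' c1)
  from IfFalse.prems IfFalse.hyps(1) obtain u' where
    "u = 1 + bcost b + u'" "exec proc c2 s u' v"
    by (elim exec_IfE) auto
  with IfFalse.IH[of u' v] show ?case by simp
next
  case (WhileFalse b s c)
  show ?case by (rule exec_WhileE[OF WhileFalse.prems]) (use WhileFalse.hyps in auto)
next
  case (WhileTrue b s c t1 s' t2 s'')
  obtain u1 r u2 where
    r: "u = 1 + bcost b + u1 + u2" "exec proc c s u1 r" "exec proc (While b c) r u2 v"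
    by (rule exec_WhileE[OF WhileTrue.prems]) (use WhileTrue.hyps(1) in auto)
  from WhileTrue.IH(1)[OF r(2)] have "u1 = t1" "r = s'" by simp_all
  with r WhileTrue.IH(2)[of u2 v] show ?case by simp
next
  case (Call e s t a x)
  from Call.prems obtain t' a' where
    "u = Suc (ncost e + t')" "v = s\<lparr>rmem := (rmem s)(x := a')\<rparr>" "proc (neval e s) t' a'"
    by (rule exec_CallE)
  with det[OF Call.hyps] show ?case by simp
qed

primrec rexp_consts :: "rexp \<Rightarrow> real set" where
  "rexp_consts (RConst c) = {c}"
| "rexp_consts (RCell x es) = {}"
| "rexp_consts (RAdd e f) = rexp_consts e \<union> rexp_consts f"
| "rexp_consts (RSub e f) = rexp_consts e \<union> rexp_consts f"
| "rexp_consts (RMul e f) = rexp_consts e \<union> rexp_consts f"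
| "rexp_consts (RDiv e f) = rexp_consts e \<union> rexp_consts f"

primrec bexp_consts :: "bexp \<Rightarrow> real set" where
  "bexp_consts (NEq e f) = {}"
| "bexp_consts (NLess e f) = {}"
| "bexp_consts (REq e f) = rexp_consts e \<union> rexp_consts f"
| "bexp_consts (RLess e f) = rexp_consts e \<union> rexp_consts f"
| "bexp_consts (Not b) = bexp_consts b"
| "bexp_consts (And b c) = bexp_consts b \<union> bexp_consts c"

primrec real_consts :: "com \<Rightarrow> real set" where
  "real_consts Skip = {}"
| "real_consts (NAssign x es e) = {}"
| "real_consts (RAssign x es e) = rexp_consts e"
| "real_consts (Seq c1 c2) = real_consts c1 \<union> real_consts c2"
| "real_consts (If b c1 c2) = bexp_consts b \<union> real_consts c1 \<union> real_consts c2"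
| "real_consts (While b c) = bexp_consts b \<union> real_consts c"
| "real_consts (Call x e) = {}"

section \<open>The computational problem\<close>

text \<open>Arrays of dimensions 0, 1 and 3; cells outside the given bounds are 0, so that an
  encoded instance carries no information beyond the instance itself.\<close>

definition arr0 :: "'v::zero \<Rightarrow> nat list \<Rightarrow> 'v" where
  "arr0 v = (\<lambda>js. if js = [] then v else 0)"

definition arr1 :: "nat \<Rightarrow> (nat \<Rightarrow> 'v::zero) \<Rightarrow> nat list \<Rightarrow> 'v" where
  "arr1 n f = (\<lambda>js. case js of [a] \<Rightarrow> if a < n then f a else 0 | _ \<Rightarrow> 0)"

definition arr3 :: "nat \<Rightarrow> nat \<Rightarrow> nat \<Rightarrow> (nat \<Rightarrow> nat \<Rightarrow> nat \<Rightarrow> 'v::zero) \<Rightarrow> nat list \<Rightarrow> 'v" where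
  "arr3 n1 n2 n3 f =
     (\<lambda>js. case js of [a, b, c] \<Rightarrow> if a < n1 \<and> b < n2 \<and> c < n3 then f a b c else 0 | _ \<Rightarrow> 0)"

text \<open>The alphabet of size \<open>m\<close> is \<open>{..<m}\<close>.  The machine that comes with the distribution is not
  part of the memory; it is the external procedure of the algorithm.\<close>

definition shap_input :: "nat \<Rightarrow> nat wa \<Rightarrow> nat list \<Rightarrow> nat \<Rightarrow> nat markov \<Rightarrow> state" where
  "shap_input m A w i P =
     \<lparr>nmem = (\<lambda>_ _. 0)
        (''alphabet'' := arr0 m,
         ''size'' := arr0 (wa_size A),
         ''length'' := arr0 (length w),
         ''w'' := arr1 (length w) (\<lambda>j. w ! j),
         ''i'' := arr0 i),
      rmem = (\<lambda>_ _. 0)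
        (''alpha'' := arr1 (wa_size A) (\<lambda>a. vec_index (wa_alpha A) a),
         ''A'' := arr3 m (wa_size A) (wa_size A) (\<lambda>\<sigma> a b. wa_mat A \<sigma> $$ (a, b)),
         ''beta'' := arr1 (wa_size A) (\<lambda>a. vec_index (wa_beta A) a),
         ''init'' := arr1 m (mk_init P))\<rparr>"

text \<open>The procedure implemented by a machine, which itself is a program without procedure calls
  (they never terminate), run on a fresh memory with its own input \<open>n\<close> and output \<open>out\<close>.\<close>

definition machine_proc :: "com \<Rightarrow> nat \<Rightarrow> nat \<Rightarrow> (nat list \<Rightarrow> real) \<Rightarrow> bool" where
  "machine_proc mach k t a \<longleftrightarrow>
     (\<exists>s. exec (\<lambda>_ _ _. False) mach \<lparr>nmem = (\<lambda>_ _. 0)(''n'' := arr0 k), rmem = (\<lambda>_ _. 0)\<rparr> t s \<and>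
          a = rmem s ''out'')"

lemma machine_proc_deterministic:
  "machine_proc mach k t a \<Longrightarrow> machine_proc mach k t' a' \<Longrightarrow> t' = t \<and> a' = a"
  unfolding machine_proc_def by (elim exE conjE) (drule (1) exec_deterministic[rotated], simp_all)

text \<open>
  \<open>T\<close> bounds the running time on every input \<open>n\<close>; \<open>P\<close> belongs to MARKOV if some machine
  satisfies this with \<open>T n = c * (n + m) ^ d\<close> for some \<open>c\<close> and \<open>d\<close>.  A polynomial
  in several naturals with positive sum is always bounded by such an expression in their sum.

  Machines may contain arbitrary real constants.  For an algorithm that is to be uniform over
  instances, \<open>real_consts\<close> should be restricted to \<open>\<rat>\<close>, as arbitrary real constants could
  encode non-computable advice.
\<close>

definition computes_markov :: "nat \<Rightarrow> nat markov \<Rightarrow> com \<Rightarrow> (nat \<Rightarrow> nat) \<Rightarrow> bool" where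
  "computes_markov m P mach T \<longleftrightarrow>
     (\<forall>n\<ge>1. \<exists>t a. machine_proc mach n t a \<and> t \<le> T n \<and>
        (\<forall>\<sigma><m. \<forall>\<tau><m. a [\<sigma>, \<tau>] = mk_trans P n \<sigma> \<tau>))"

end

theory Submission
  imports Defs
begin

text \<open>
  Since $P$ is Markovian, fixing the symbol at a position separates the past from the future.
  Normalising the weights of the words that match a prefix $p$ of a pattern, sorted by their last
  symbol, by the total weight of $p$ therefore gives numbers which depend only on $|p|$ and on the
  last fixed position of $p$, and appending a fixed symbol divides by one of these numbers.  So the
  sum over all patterns of the normalised weight vectors, sorted by the last fixed position, the
  number of wildcards and whether position $i$ is a wildcard, obeys a recursion in $|p|$ with
  polynomially many entries.  No normalisation is left at the end because transition rows sum to 1.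

  In a difference $V(p) - V(\mathrm{swap}(p,i))$ only the patterns with $p_i$ fixed contribute, and
  for them $p \mapsto \mathrm{swap}(p,i)$ is a bijection onto the patterns with one wildcard more and
  a wildcard at $i$.
\<close>

section \<open>Loops that accumulate sums\<close>

text \<open>Every pattern has its own normaliser, the probability of \<open>L_p\<close>, and there
  are exponentially many patterns, so no common denominator can be divided out after the numerators
  are summed. Hence the division is spread over the steps of the recursion, and the table must
  remember just enough of a prefix to know the next divisor. The machine shapes the rest. An
  invariant for seven nested loops would have to describe half-filled tables at seven levels. Every
  table is therefore filled by adding to cells that start at 0: additions commute, the effect of a
  nest is one iterated sum, and correctness becomes the identity of this sum with a recursion
  written in the same form. Tables carry the position as first index, so that a step reads one layer
  and writes the next. Naturals cannot be multiplied or turned into reals; the factors 1/(|w|-k) and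
  the numbers of patterns come from real tables filled by counting and by Pascal's rule.\<close>

abbreviation "nvar x \<equiv> NCell x []"

definition for_loop :: "string \<Rightarrow> nexp \<Rightarrow> com \<Rightarrow> com" where
  "for_loop x e c =
     Seq (NAssign x [] (NConst 0))
       (While (NLess (nvar x) e) (Seq c (NAssign x [] (NAdd (nvar x) (NConst 1)))))"

text \<open>The product form of the bound lets nested loops multiply their costs. The invariant must
  tolerate any value of the counter, so the body receives this value as a separate premise.\<close>

lemma for_loop_exec:
  assumes body: "\<And>k s. k < N \<Longrightarrow> I k s \<Longrightarrow> nmem s x [] = k \<Longrightarrow>
      \<exists>t s'. exec proc c s t s' \<and> t \<le> T \<and> nmem s' x [] = k \<and> I (Suc k) s'"
    and bound: "\<And>k s. k \<le> N \<Longrightarrow> I k s \<Longrightarrow> neval e s = N"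
    and upd: "\<And>k k' s. I k s \<Longrightarrow> I k (nupdate x [] k' s)"
    and cost: "ncost e \<le> 5" and TB: "1 \<le> T" "N < B"
    and init: "I 0 s"
  shows "\<exists>t s'. exec proc (for_loop x e c) s t s' \<and> t \<le> 13 * B * T \<and> I N s'"
proof -
  let ?body = "Seq c (NAssign x [] (NAdd (nvar x) (NConst 1)))"
  let ?W = "While (NLess (nvar x) e) ?body"
  have loop: "\<exists>t s'. exec proc ?W s t s' \<and> t \<le> (N - k) * (12 + T) + 8 \<and> I N s'"
    if "k \<le> N" "I k s" "nmem s x [] = k" for k s
    using that
  proof (induction "N - k" arbitrary: k s)
    case 0
    then have "k = N" by simp
    with 0 bound[of k s] have "exec proc ?W s (1 + bcost (NLess (nvar x) e)) s"
      by (intro exec.WhileFalse) simp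
    moreover have "1 + bcost (NLess (nvar x) e) \<le> 8" using cost by simp
    ultimately show ?case using 0 \<open>k = N\<close> by (metis trans_le_add2)
  next
    case (Suc d)
    then have kN: "k < N" by simp
    from body[OF kN Suc.prems(2,3)] obtain t1 s1 where s1:
      "exec proc c s t1 s1" "t1 \<le> T" "nmem s1 x [] = k" "I (Suc k) s1" by blast
    let ?s2 = "nupdate x [] (Suc k) s1"
    have e: "exec proc (NAssign x [] (NAdd (nvar x) (NConst 1))) s1 4 ?s2"
      using exec.NAssign[of proc x "[]" "NAdd (nvar x) (NConst 1)" s1] s1(3)
      by (simp add: numeral_eq_Suc)
    have s2: "I (Suc k) ?s2" "nmem ?s2 x [] = Suc k"
      using upd[OF s1(4)] by (auto simp: nupdate_def)
    obtain t2 s' where s': "exec proc ?W ?s2 t2 s'" "t2 \<le> (N - Suc k) * (12 + T) + 8" "I N s'"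
    proof -
      have "d = N - Suc k" "Suc k \<le> N" using Suc.hyps(2) kN by simp_all
      from Suc.hyps(1)[OF this s2] show ?thesis using that by blast
    qed
    have "exec proc ?W s (1 + bcost (NLess (nvar x) e) + (t1 + 4) + t2) s'"
      using bound[of k s] Suc.prems kN
      by (intro exec.WhileTrue[OF _ exec.Seq[OF s1(1) e] s'(1)]) simp
    moreover have "N - k = Suc (N - Suc k)" using kN by simp
    then have "1 + bcost (NLess (nvar x) e) + (t1 + 4) + t2 \<le> (N - k) * (12 + T) + 8"
      using s1(2) s'(2) cost by simp
    ultimately show ?case using s'(3) by blast
  qed
  have "exec proc (NAssign x [] (NConst 0)) s 2 (nupdate x [] 0 s)"
    using exec.NAssign[of proc x "[]" "NConst 0" s] by (simp add: numeral_eq_Suc)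
  moreover obtain t s' where "exec proc ?W (nupdate x [] 0 s) t s'"
      "t \<le> N * (12 + T) + 8" "I N s'"
    using loop[of 0 "nupdate x [] 0 s"] upd[OF init] by (auto simp: nupdate_def)
  \<comment> \<open>A round costs at most 8 for the test, 4 for the increment and \<open>T\<close>
    for the body; the first assignment costs 2 and the last test 8. As \<open>1 \<le> T\<close>,
    each round and the remaining 10 fit into \<open>13 * T\<close>, and there are
    \<open>N + 1 \<le> B\<close> such portions.\<close>
  moreover have "2 + (N * (12 + T) + 8) \<le> 13 * B * T"
  proof -
    have "12 + T \<le> 13 * T" using TB by simp
    then have "N * (12 + T) \<le> N * (13 * T)" by (rule mult_le_mono2)
    moreover have "10 \<le> 13 * T" using TB by simp
    moreover have "Suc N * (13 * T) \<le> B * (13 * T)" using TB by (intro mult_le_mono1) simp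
    moreover have "Suc N * (13 * T) = N * (13 * T) + 13 * T" "13 * B * T = B * (13 * T)" by simp_all
    ultimately show ?thesis by linarith
  qed
  ultimately show ?thesis
    unfolding for_loop_def by (intro exI[of _ "2 + t"] exI[of _ s'])
      (auto simp del: add_2_eq_Suc intro: exec.Seq)
qed

text \<open>
  \<open>adds proc c s X y W G T\<close>: whenever the loop counters \<open>X\<close> and the cells of \<open>y\<close> outside \<open>W\<close>
  may differ from those in \<open>s\<close>, the program \<open>c\<close> adds the array \<open>G\<close> to \<open>y\<close>.  Reads from \<open>y\<close>
  itself go to the cells in \<open>W\<close>, which are never written, so that the order of the additions
  does not matter.
\<close>

definition same_nmem :: "string set \<Rightarrow> state \<Rightarrow> state \<Rightarrow> bool" where
  "same_nmem X s s' \<longleftrightarrow> (\<forall>z js. z \<notin> X \<or> js \<noteq> [] \<longrightarrow> nmem s' z js = nmem s z js)"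

definition agree :: "string set \<Rightarrow> string \<Rightarrow> nat list set \<Rightarrow> state \<Rightarrow> state \<Rightarrow> bool" where
  "agree X y W s s' \<longleftrightarrow>
     same_nmem X s s' \<and> (\<forall>z. z \<noteq> y \<longrightarrow> rmem s' z = rmem s z) \<and>
     (\<forall>js\<in>W. rmem s' y js = rmem s y js)"

definition adds ::
  "(nat \<Rightarrow> nat \<Rightarrow> (nat list \<Rightarrow> real) \<Rightarrow> bool) \<Rightarrow> com \<Rightarrow> state \<Rightarrow> string set \<Rightarrow> string \<Rightarrow>
     nat list set \<Rightarrow> (nat list \<Rightarrow> real) \<Rightarrow> nat \<Rightarrow> bool" where
  "adds proc c s X y W G T \<longleftrightarrow>
     1 \<le> T \<and> (\<forall>js\<in>W. G js = 0) \<and>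
     (\<forall>s'. agree X y W s s' \<longrightarrow>
       (\<exists>t s''. exec proc c s' t s'' \<and> t \<le> T \<and> same_nmem X s' s'' \<and>
          rmem s'' = (rmem s')(y := (\<lambda>js. rmem s' y js + G js))))"

definition add_cell :: "string \<Rightarrow> nexp list \<Rightarrow> rexp \<Rightarrow> com" where
  "add_cell y es e = RAssign y es (RAdd (RCell y es) e)"

text \<open>The index list is evaluated twice, for the write and for the read of the old value; this
  gives the factor 2 in the cost.\<close>

lemma adds_add_cell:
  assumes "\<And>s'. agree {} y W s s' \<Longrightarrow> reval e s' = v"
    and "map (\<lambda>e. neval e s) es = ks" "ks \<notin> W"
    and T: "3 + 2 * sum_list (map ncost es) + rcost e \<le> T"
  shows "adds proc (add_cell y es e) s {} y W (\<lambda>js. if js = ks then v else 0) T"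
  unfolding adds_def
proof (intro conjI allI impI ballI)
  show "1 \<le> T" using T by simp
  show "(if js = ks then v else 0) = 0" if "js \<in> W" for js
    using assms(3) that by auto
  fix s' assume s': "agree {} y W s s'"
  then have n: "nmem s' = nmem s" by (auto simp: agree_def same_nmem_def fun_eq_iff)
  have nev: "neval e' s' = neval e' s" for e' :: nexp
    by (induction e') (auto simp: n intro!: arg_cong[where f = "nmem s _"])
  have ks: "map (\<lambda>e. neval e s') es = ks" using assms(2) nev by simp
  let ?s = "rupdate y ks (rmem s' y ks + v) s'"
  have "exec proc (add_cell y es e) s'
      (1 + sum_list (map ncost es) + rcost (RAdd (RCell y es) e)) ?s"
    unfolding add_cell_def
    using exec.RAssign[of proc y es "RAdd (RCell y es) e" s'] ks assms(1)[OF s'] by simp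
  moreover have "1 + sum_list (map ncost es) + rcost (RAdd (RCell y es) e) \<le> T"
    using T by simp
  moreover have "rmem ?s = (rmem s')(y := (\<lambda>js. rmem s' y js + (if js = ks then v else 0)))"
    by (auto simp: rupdate_def fun_eq_iff)
  moreover have "nmem ?s = nmem s'" by (simp add: rupdate_def)
  ultimately show "\<exists>t s''. exec proc (add_cell y es e) s' t s'' \<and> t \<le> T \<and>
      same_nmem {} s' s'' \<and>
      rmem s'' = (rmem s')(y := (\<lambda>js. rmem s' y js + (if js = ks then v else 0)))"
    unfolding same_nmem_def by metis
qed

text \<open>The premise on the body speaks of \<open>s\<close> with the counter set, not of the
  state reached after \<open>k\<close> rounds, because \<open>adds\<close> already quantifies over
  all states that agree with it. Nests can thus be treated by plain backward application.\<close>

lemma adds_for_loop: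
  assumes body: "\<And>k. k < N \<Longrightarrow> adds proc c (nupdate x [] k s) X y W (G k) T"
    and bound: "\<And>s'. same_nmem (insert x X) s s' \<Longrightarrow> neval e s' = N"
    and x: "x \<notin> X" and cost: "ncost e \<le> 5" and TB: "1 \<le> T" "N < B"
  shows "adds proc (for_loop x e c) s (insert x X) y W (\<lambda>js. \<Sum>k<N. G k js) (13 * B * T)"
  unfolding adds_def
proof (intro conjI allI impI ballI)
  show "1 \<le> 13 * B * T" using TB by (simp add: Suc_le_eq)
  have W0: "G k js = 0" if "k < N" "js \<in> W" for k js
    using body[OF that(1)] that(2) by (auto simp: adds_def)
  show "(\<Sum>k<N. G k js) = 0" if "js \<in> W" for js
    using W0[OF _ that] by simp
  fix s' assume s': "agree (insert x X) y W s s'"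
  define I where "I k r \<longleftrightarrow> same_nmem (insert x X) s' r \<and>
      rmem r = (rmem s')(y := (\<lambda>js. rmem s' y js + (\<Sum>l<k. G l js)))" for k :: nat and r :: state
  have "\<exists>t s''. exec proc (for_loop x e c) s' t s'' \<and> t \<le> 13 * B * T \<and> I N s''"
  proof (rule for_loop_exec[where I = I])
    fix k r assume k: "k < N" and I: "I k r" and rx: "nmem r x [] = k"
    \<comment> \<open>The increments of the earlier rounds vanish on \<open>W\<close>, so the cells
      of \<open>y\<close> that the body may read still have their values from
      \<open>s\<close>.\<close>
    have "agree X y W (nupdate x [] k s) r"
      using s' I rx k W0
      by (auto simp: agree_def I_def same_nmem_def nupdate_def intro!: sum.neutral)
    then obtain t r' where r': "exec proc c r t r'" "t \<le> T" "same_nmem X r r'"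
        "rmem r' = (rmem r)(y := (\<lambda>js. rmem r y js + G k js))"
      using body[OF k] by (auto simp: adds_def)
    have "nmem r' x [] = k" using r'(3) x rx by (auto simp: same_nmem_def)
    moreover have "I (Suc k) r'" using I r'(3,4)
      by (auto simp: I_def same_nmem_def fun_eq_iff algebra_simps)
    ultimately show "\<exists>t s'. exec proc c r t s' \<and> t \<le> T \<and> nmem s' x [] = k \<and> I (Suc k) s'"
      using r'(1,2) by blast
  next
    fix k r assume "I k r"
    then show "neval e r = N"
      using s' by (intro bound) (auto simp: I_def agree_def same_nmem_def)
  next
    fix k k' r assume "I k r"
    then show "I k (nupdate x [] k' r)"
      by (auto simp: I_def same_nmem_def nupdate_def)
  qed (use cost TB in \<open>auto simp: I_def same_nmem_def\<close>)
  then show "\<exists>t s''. exec proc (for_loop x e c) s' t s'' \<and> t \<le> 13 * B * T \<and>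
      same_nmem (insert x X) s' s'' \<and>
      rmem s'' = (rmem s')(y := (\<lambda>js. rmem s' y js + (\<Sum>k<N. G k js)))"
    by (auto simp: I_def)
qed

section \<open>Pattern prefixes\<close>

definition prefix_patterns :: "'a list \<Rightarrow> nat \<Rightarrow> 'a option list set" where
  "prefix_patterns w c = {p. length p = c \<and> (\<forall>k<c. p ! k = None \<or> p ! k = Some (w ! k))}"

lemma prefix_patterns_0: "prefix_patterns w 0 = {[]}"
  by (auto simp: prefix_patterns_def)

lemma prefix_patterns_Suc:
  "prefix_patterns w (Suc c) =
     (\<lambda>p. p @ [None]) ` prefix_patterns w c \<union> (\<lambda>p. p @ [Some (w ! c)]) ` prefix_patterns w c"
proof (intro Set.set_eqI iffI)
  fix p assume p: "p \<in> prefix_patterns w (Suc c)"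
  then obtain r x where r: "p = r @ [x]"
    by (cases p rule: rev_cases) (auto simp: prefix_patterns_def)
  have "x = None \<or> x = Some (w ! c)" and "r \<in> prefix_patterns w c"
    using p by (auto simp: r prefix_patterns_def nth_append less_Suc_eq split: if_splits)
  with r show "p \<in> (\<lambda>p. p @ [None]) ` prefix_patterns w c \<union>
      (\<lambda>p. p @ [Some (w ! c)]) ` prefix_patterns w c" by auto
qed (auto simp: prefix_patterns_def nth_append less_Suc_eq)

lemma finite_prefix_patterns [simp]: "finite (prefix_patterns w c)"
  by (induction c) (auto simp: prefix_patterns_0 prefix_patterns_Suc)

lemma sum_prefix_patterns_Suc:
  fixes f :: "'a option list \<Rightarrow> 'b::comm_monoid_add"
  shows "(\<Sum>p\<in>prefix_patterns w (Suc c). f p) =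
    (\<Sum>p\<in>prefix_patterns w c. f (p @ [None])) +
    (\<Sum>p\<in>prefix_patterns w c. f (p @ [Some (w ! c)]))"
  unfolding prefix_patterns_Suc
  by (subst sum.union_disjoint) (auto simp: sum.reindex inj_on_def)

lemma list_update_prefix_patterns:
  assumes "p \<in> prefix_patterns w c" "x = None \<or> x = Some (w ! k)"
  shows "p[k := x] \<in> prefix_patterns w c"
proof -
  have "p[k := x] ! l = None \<or> p[k := x] ! l = Some (w ! l)" if "l < c" for l
    using assms that by (cases "l = k") (simp_all add: prefix_patterns_def)
  then show ?thesis using assms(1) by (simp add: prefix_patterns_def)
qed

lemma patterns_eq:
  assumes "set w \<subseteq> \<Sigma>"
  shows "patterns \<Sigma> w k = {p \<in> prefix_patterns w (length w). count_list p None = k}"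
proof -
  have "set p \<subseteq> insert None (Some ` \<Sigma>)"
    if "length p = length w" "\<forall>k<length w. p ! k = None \<or> p ! k = Some (w ! k)" for p
  proof
    fix x assume "x \<in> set p"
    then obtain k where "k < length p" "p ! k = x" by (auto simp: in_set_conv_nth)
    with that assms show "x \<in> insert None (Some ` \<Sigma>)"
      by (metis image_eqI insert_iff nth_mem subsetD)
  qed
  moreover have "w \<in> pattern_lang \<Sigma> p \<longleftrightarrow> (\<forall>k<length w. p ! k = None \<or> p ! k = Some (w ! k))"
    if "length p = length w" for p
    using assms that by (simp add: pattern_lang_def words_def)
  ultimately show ?thesis
    unfolding patterns_def prefix_patterns_def by blast
qed

text \<open>A number and not a truth value because it serves as an array index. For
  \<open>i \<ge> 1\<close> it stays 0 until the prefix reaches position \<open>i\<close>.\<close>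

definition wildcard_at :: "nat \<Rightarrow> 'a option list \<Rightarrow> nat" where
  "wildcard_at i p = (if i \<le> length p \<and> p ! (i - 1) = None then 1 else 0)"

lemma wildcard_at_snoc:
  assumes "1 \<le> i"
  shows "wildcard_at i (p @ [x]) =
     wildcard_at i p + (if x = None \<and> i = Suc (length p) then 1 else 0)"
  using assms by (auto simp: wildcard_at_def nth_append)

lemma wildcard_at_less: "wildcard_at i p < 2"
  by (simp add: wildcard_at_def)

lemma wildcard_at_Nil: "1 \<le> i \<Longrightarrow> wildcard_at i [] = 0"
  by (simp add: wildcard_at_def)

text \<open>Counted from 1; the value 0 stands for the virtual start position.\<close>

definition last_fixed :: "'a option list \<Rightarrow> nat" where
  "last_fixed p = length (dropWhile (\<lambda>x. x = None) (rev p))"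

lemma last_fixed_simps [simp]:
  "last_fixed [] = 0" "last_fixed (p @ [None]) = last_fixed p"
  "last_fixed (p @ [Some b]) = Suc (length p)"
  by (simp_all add: last_fixed_def)

lemma last_fixed_le: "last_fixed p \<le> length p"
  unfolding last_fixed_def using length_dropWhile_le[of _ "rev p"] by simp

section \<open>Conditional weights of patterns\<close>

locale shap_instance =
  fixes m :: nat and A :: "nat wa" and w :: "nat list" and i :: nat and P :: "nat markov"
  assumes A: "weighted_automaton {..<m} A" and w: "set w \<subseteq> {..<m}"
    and i: "1 \<le> i" "i \<le> length w" and P: "markovian {..<m} P"
begin

abbreviation "n \<equiv> wa_size A"
abbreviation "L \<equiv> length w"

text \<open>The initial probabilities sum to 1, so the alphabet is nonempty and the virtual symbol 0
  is a legal index.\<close>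

lemma m_pos: "0 < m"
  using P by (cases m) (auto simp: markovian_def)

lemma w_less: "c < L \<Longrightarrow> w ! c < m"
  using w by (meson lessThan_iff nth_mem subsetD)

text \<open>A virtual position 0 carries the fixed symbol 0 and the initial distribution becomes the
  transition out of it.\<close>

definition step_prob :: "nat \<Rightarrow> nat \<Rightarrow> nat \<Rightarrow> real" where
  "step_prob c a b = (if c = 0 then mk_init P b else mk_trans P c a b)"

definition last0 :: "nat list \<Rightarrow> nat" where
  "last0 x = (if x = [] then 0 else last x)"

text \<open>\<open>markov_weight\<close> looks at \<open>u ! 0\<close>, so the empty word gets the
  value of an empty product separately.\<close>

definition weight :: "nat list \<Rightarrow> real" where
  "weight x = (if x = [] then 1 else markov_weight P x)"

text \<open>Entry \<open>q\<close> of the row vector \<alpha>^T A_{x_1} ... A_{x_k} reached after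
  reading \<open>x\<close>.\<close>

definition run_vec :: "nat list \<Rightarrow> nat \<Rightarrow> real" where
  "run_vec x q = (\<Sum>q'<n. vec_index (wa_alpha A) q' * foldr (\<lambda>\<sigma> M. wa_mat A \<sigma> * M) x (1\<^sub>m n) $$ (q', q))"

definition matches :: "nat option list \<Rightarrow> nat list set" where
  "matches p = pattern_lang {..<m} p"

lemma step_prob_pos: "a < m \<Longrightarrow> b < m \<Longrightarrow> 0 < step_prob c a b"
  using P by (auto simp: step_prob_def markovian_def)

lemma sum_step_prob: "a < m \<Longrightarrow> (\<Sum>b<m. step_prob c a b) = 1"
  using P by (cases "c = 0") (auto simp: step_prob_def markovian_def)

lemma weight_snoc: "weight (x @ [b]) = weight x * step_prob (length x) (last0 x) b"
  by (cases "x = []")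
     (auto simp: weight_def step_prob_def last0_def markov_weight_snoc, simp add: markov_weight_def)

lemma foldr_mat_carrier:
  assumes "set x \<subseteq> {..<m}"
  shows "foldr (\<lambda>\<sigma> M. wa_mat A \<sigma> * M) x (1\<^sub>m n) \<in> carrier_mat n n"
  using assms A by (induction x) (auto simp: weighted_automaton_def intro: mult_carrier_mat)

text \<open>\<open>foldr\<close> peels symbols off the front while the recursion extends words at
  the end; associativity of the product reconciles the two.\<close>

lemma foldr_mat_snoc:
  assumes "set x \<subseteq> {..<m}" "b < m"
  shows "foldr (\<lambda>\<sigma> M. wa_mat A \<sigma> * M) (x @ [b]) (1\<^sub>m n) =
    foldr (\<lambda>\<sigma> M. wa_mat A \<sigma> * M) x (1\<^sub>m n) * wa_mat A b"
  using assms
proof (induction x)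
  case Nil
  then have "wa_mat A b \<in> carrier_mat n n" using A by (auto simp: weighted_automaton_def)
  then show ?case by simp
next
  case (Cons a x)
  have "wa_mat A a \<in> carrier_mat n n" "wa_mat A b \<in> carrier_mat n n"
    using A Cons.prems by (auto simp: weighted_automaton_def)
  then show ?case
    using Cons foldr_mat_carrier[of x] by (simp add: assoc_mult_mat[of _ n n _ n _ n])
qed

lemma run_vec_Nil: "q < n \<Longrightarrow> run_vec [] q = vec_index (wa_alpha A) q"
  by (simp add: run_vec_def if_distrib[of "\<lambda>x. _ * x"] cong: if_cong)

lemma run_vec_snoc:
  assumes "set x \<subseteq> {..<m}" "b < m" "q < n"
  shows "run_vec (x @ [b]) q = (\<Sum>q'<n. run_vec x q' * wa_mat A b $$ (q', q))"
proof -
  let ?M = "foldr (\<lambda>\<sigma> M. wa_mat A \<sigma> * M) x (1\<^sub>m n)"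
  have M: "?M \<in> carrier_mat n n" by (rule foldr_mat_carrier) fact
  have B: "wa_mat A b \<in> carrier_mat n n" using A assms by (auto simp: weighted_automaton_def)
  have "run_vec (x @ [b]) q =
      (\<Sum>q''<n. vec_index (wa_alpha A) q'' * (\<Sum>q'<n. ?M $$ (q'', q') * wa_mat A b $$ (q', q)))"
    unfolding run_vec_def foldr_mat_snoc[OF assms(1,2)] using M B assms
    by (intro sum.cong refl) (simp add: scalar_prod_def atLeast0LessThan)
  also have "\<dots> = (\<Sum>q'<n. run_vec x q' * wa_mat A b $$ (q', q))"
    unfolding run_vec_def sum_distrib_left sum_distrib_right
    by (subst sum.swap) (simp add: mult.assoc)
  finally show ?thesis .
qed

lemma wa_lang_eq:
  assumes "set x \<subseteq> {..<m}"
  shows "wa_lang A x = (\<Sum>q<n. run_vec x q * vec_index (wa_beta A) q)"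
proof -
  let ?M = "foldr (\<lambda>\<sigma> M. wa_mat A \<sigma> * M) x (1\<^sub>m n)"
  have M: "?M \<in> carrier_mat n n" by (rule foldr_mat_carrier) fact
  have b: "wa_beta A \<in> carrier_vec n" "wa_alpha A \<in> carrier_vec n"
    using A by (auto simp: weighted_automaton_def)
  have "wa_lang A x = (\<Sum>q'<n. vec_index (wa_alpha A) q' * (\<Sum>q<n. ?M $$ (q', q) * vec_index (wa_beta A) q))"
    unfolding wa_lang_def using M b by (simp add: scalar_prod_def atLeast0LessThan)
  also have "\<dots> = (\<Sum>q<n. run_vec x q * vec_index (wa_beta A) q)"
    unfolding run_vec_def sum_distrib_left sum_distrib_right
    by (subst sum.swap) (simp add: mult.assoc)
  finally show ?thesis .
qed

section \<open>Words that match a prefix\<close>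

lemma matchesD:
  assumes "x \<in> matches p"
  shows "set x \<subseteq> {..<m}" "length x = length p" "last0 x < m"
proof -
  show *: "set x \<subseteq> {..<m}" "length x = length p"
    using assms by (auto simp: matches_def pattern_lang_def words_def)
  show "last0 x < m"
    using * m_pos by (cases x rule: rev_cases) (auto simp: last0_def)
qed

lemma finite_matches [simp]: "finite (matches p)"
proof (rule finite_subset)
  show "matches p \<subseteq> {x. set x \<subseteq> {..<m} \<and> length x = length p}" using matchesD by blast
qed (rule finite_lists_length_eq, simp)

lemma matches_Nil: "matches [] = {[]}"
  by (auto simp: matches_def pattern_lang_def words_def)

lemma snoc_matches_iff:
  "x @ [b] \<in> matches (p @ [y]) \<longleftrightarrow> x \<in> matches p \<and> b < m \<and> (y = None \<or> y = Some b)"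
  by (auto simp: matches_def pattern_lang_def words_def nth_append less_Suc_eq)

lemma matches_snocE:
  assumes "x' \<in> matches (p @ [y])"
  obtains x b where "x' = x @ [b]"
  using assms that by (cases x' rule: rev_cases) (auto simp: matches_def pattern_lang_def words_def)

lemma matches_snoc_None: "matches (p @ [None]) = (\<lambda>(x, b). x @ [b]) ` (matches p \<times> {..<m})"
proof (intro Set.set_eqI iffI)
  fix y assume y: "y \<in> matches (p @ [None])"
  then show "y \<in> (\<lambda>(x, b). x @ [b]) ` (matches p \<times> {..<m})"
    by (rule matches_snocE) (use y in \<open>auto simp: snoc_matches_iff image_iff\<close>)
qed (auto simp: snoc_matches_iff)

lemma matches_snoc_Some:
  assumes "b < m"
  shows "matches (p @ [Some b]) = (\<lambda>x. x @ [b]) ` matches p"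
proof (intro Set.set_eqI iffI)
  fix y assume y: "y \<in> matches (p @ [Some b])"
  then show "y \<in> (\<lambda>x. x @ [b]) ` matches p"
    by (rule matches_snocE) (use y in \<open>auto simp: snoc_matches_iff\<close>)
qed (auto simp: snoc_matches_iff assms)

lemma sum_matches_snoc_None:
  fixes f :: "nat list \<Rightarrow> real"
  shows "(\<Sum>x\<in>matches (p @ [None]). f x) = (\<Sum>x\<in>matches p. \<Sum>b<m. f (x @ [b]))"
  unfolding matches_snoc_None
  by (subst sum.reindex) (auto simp: inj_on_def sum.cartesian_product case_prod_beta)

lemma sum_matches_snoc_Some:
  fixes f :: "nat list \<Rightarrow> real"
  shows "b < m \<Longrightarrow> (\<Sum>x\<in>matches (p @ [Some b]). f x) = (\<Sum>x\<in>matches p. f (x @ [b]))"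
  unfolding matches_snoc_Some by (subst sum.reindex) (auto simp: inj_on_def)

section \<open>Normalised weights and their one-step recursions\<close>

definition mass :: "nat option list \<Rightarrow> real" where
  "mass p = (\<Sum>x\<in>matches p. weight x)"

text \<open>With \<open>mass p\<close> the probability of matching \<open>p\<close>, this is the
  conditional probability of ending in \<sigma>; the empty word ends in the virtual symbol
  0.\<close>

definition cond :: "nat option list \<Rightarrow> nat \<Rightarrow> real" where
  "cond p \<sigma> = (\<Sum>x\<in>matches p. if last0 x = \<sigma> then weight x else 0) / mass p"

text \<open>The conditional expectation of the automaton's row vector, restricted to the words that
  end in \<sigma>.\<close>

definition cond_vec :: "nat option list \<Rightarrow> nat \<Rightarrow> nat \<Rightarrow> real" where
  "cond_vec p \<sigma> q =
     (\<Sum>x\<in>matches p. if last0 x = \<sigma> then weight x * run_vec x q else 0) / mass p"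

text \<open>The next transition sees the past only through the last symbol, so words may be grouped
  by it; this is how the Markov property is used.\<close>

lemma sum_matches_by_last:
  fixes f :: "nat list \<Rightarrow> real"
  shows "(\<Sum>x\<in>matches p. f x * g (last0 x)) =
    (\<Sum>\<tau><m. (\<Sum>x\<in>matches p. if last0 x = \<tau> then f x else 0) * g \<tau>)"
proof -
  have "f x * g (last0 x) = (\<Sum>\<tau><m. (if last0 x = \<tau> then f x else 0) * g \<tau>)"
    if "x \<in> matches p" for x
  proof -
    have "(\<Sum>\<tau><m. (if last0 x = \<tau> then f x else 0) * g \<tau>) =
        (\<Sum>\<tau><m. if last0 x = \<tau> then f x * g \<tau> else 0)"
      by (intro sum.cong) auto
    then show ?thesis using matchesD(3)[OF that] by simp
  qed
  then have "(\<Sum>x\<in>matches p. f x * g (last0 x)) =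
      (\<Sum>x\<in>matches p. \<Sum>\<tau><m. (if last0 x = \<tau> then f x else 0) * g \<tau>)" by simp
  then show ?thesis by (subst (asm) sum.swap) (simp add: sum_distrib_right)
qed

lemma sum_cond:
  "(\<Sum>x\<in>matches p. weight x * g (last0 x)) / mass p = (\<Sum>\<tau><m. cond p \<tau> * g \<tau>)"
  using sum_matches_by_last[of weight g p] by (simp add: sum_divide_distrib[of _ "{..<m}"] cond_def)

lemma sum_cond_vec:
  "(\<Sum>x\<in>matches p. weight x * run_vec x q * g (last0 x)) / mass p =
    (\<Sum>\<tau><m. cond_vec p \<tau> q * g \<tau>)"
  using sum_matches_by_last[of "\<lambda>x. weight x * run_vec x q" g p]
  by (simp add: sum_divide_distrib[of _ "{..<m}"] cond_vec_def)

text \<open>Shared by wildcard and fixed steps, which extend words in the same way and differ only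
  in the new normaliser.\<close>

lemma sum_cond_vec_step:
  assumes "\<sigma> < m" "q < n"
  shows "(\<Sum>x\<in>matches p. weight (x @ [\<sigma>]) * run_vec (x @ [\<sigma>]) q) / mass p =
    (\<Sum>\<tau><m. \<Sum>q'<n. cond_vec p \<tau> q' * step_prob (length p) \<tau> \<sigma> * wa_mat A \<sigma> $$ (q', q))"
proof -
  let ?g = "\<lambda>q' \<tau>. step_prob (length p) \<tau> \<sigma> * wa_mat A \<sigma> $$ (q', q)"
  have "(\<Sum>x\<in>matches p. weight (x @ [\<sigma>]) * run_vec (x @ [\<sigma>]) q) =
      (\<Sum>x\<in>matches p. \<Sum>q'<n. weight x * run_vec x q' * ?g q' (last0 x))"
    using assms matchesD(1,2)
    by (intro sum.cong) (simp_all add: weight_snoc run_vec_snoc sum_distrib_left mult_ac)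
  also have "\<dots> = (\<Sum>q'<n. \<Sum>x\<in>matches p. weight x * run_vec x q' * ?g q' (last0 x))"
    by (rule sum.swap)
  also have "\<dots> / mass p =
      (\<Sum>q'<n. (\<Sum>x\<in>matches p. weight x * run_vec x q' * ?g q' (last0 x)) / mass p)"
    by (rule sum_divide_distrib)
  also have "\<dots> = (\<Sum>q'<n. \<Sum>\<tau><m. cond_vec p \<tau> q' * ?g q' \<tau>)"
    by (intro sum.cong refl sum_cond_vec[where g = "?g q'" for q'])
  also have "\<dots> = (\<Sum>\<tau><m. \<Sum>q'<n. cond_vec p \<tau> q' * ?g q' \<tau>)"
    by (rule sum.swap)
  finally show ?thesis by (simp only: mult.assoc)
qed

definition valid :: "nat option list \<Rightarrow> bool" where
  "valid p \<longleftrightarrow> set p \<subseteq> insert None (Some ` {..<m})"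

lemma mass_Nil: "mass [] = 1"
  by (simp add: mass_def matches_Nil weight_def)

text \<open>Summing over the new symbol sums a transition row, which gives 1; hence only fixed
  symbols ever cause a division.\<close>

lemma mass_snoc_None: "mass (p @ [None]) = mass p"
proof -
  have "mass (p @ [None]) = (\<Sum>x\<in>matches p. weight x * (\<Sum>b<m. step_prob (length x) (last0 x) b))"
    by (simp add: mass_def sum_matches_snoc_None weight_snoc sum_distrib_left)
  also have "\<dots> = mass p"
    unfolding mass_def using matchesD by (intro sum.cong) (auto simp: sum_step_prob)
  finally show ?thesis .
qed

text \<open>The sum is the conditional probability that \<open>b\<close> comes next, the divisor of
  a fixed step.\<close>

lemma mass_snoc_Some:
  assumes "b < m" "mass p \<noteq> 0"
  shows "mass (p @ [Some b]) = mass p * (\<Sum>\<tau><m. cond p \<tau> * step_prob (length p) \<tau> b)"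
proof -
  have "mass (p @ [Some b]) = (\<Sum>x\<in>matches p. weight x * step_prob (length p) (last0 x) b)"
    unfolding mass_def using assms(1) matchesD(2)
    by (simp add: sum_matches_snoc_Some weight_snoc)
  then show ?thesis
    using assms(2) by (simp flip: sum_cond[where g = "\<lambda>\<tau>. step_prob (length p) \<tau> b"])
qed

text \<open>Strict positivity of all transition and initial probabilities enters here. It keeps the
  normalisations away from division by 0 and makes the conditional distributions in the score
  meaningful.\<close>

lemma mass_pos: "valid p \<Longrightarrow> 0 < mass p"
proof (induction p rule: rev_induct)
  case Nil
  then show ?case by (simp add: mass_Nil)
next
  case (snoc y p)
  then have p: "0 < mass p" by (simp add: valid_def)
  show ?case
  proof (cases y)
    case None
    then show ?thesis using p by (simp add: mass_snoc_None)
  next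
    case (Some b)
    then have b: "b < m" using snoc.prems by (auto simp: valid_def)
    have ne: "matches p \<noteq> {}" using p by (auto simp: mass_def)
    have "0 < weight x * step_prob (length x) (last0 x) b" if "x \<in> matches p" for x
    proof -
      have "0 < weight x"
        using markov_weight_pos[OF P, of x "length x - 1"] matchesD[OF that]
        by (cases x) (auto simp: weight_def words_def)
      then show ?thesis using step_prob_pos[of "last0 x" b] matchesD[OF that] b by simp
    qed
    then have "0 < (\<Sum>x\<in>matches p. weight x * step_prob (length x) (last0 x) b)"
      using ne by (intro sum_pos) auto
    then show ?thesis
      using b by (simp add: Some mass_def sum_matches_snoc_Some weight_snoc)
  qed
qed

lemma cond_Nil: "cond [] \<sigma> = (if \<sigma> = 0 then 1 else 0)"
  by (simp add: cond_def mass_Nil matches_Nil last0_def weight_def)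

lemma cond_vec_Nil: "q < n \<Longrightarrow> cond_vec [] \<sigma> q = (if \<sigma> = 0 then vec_index (wa_alpha A) q else 0)"
  by (simp add: cond_vec_def mass_Nil matches_Nil last0_def weight_def run_vec_Nil)

lemma cond_snoc_None:
  assumes "\<sigma> < m"
  shows "cond (p @ [None]) \<sigma> = (\<Sum>\<tau><m. cond p \<tau> * step_prob (length p) \<tau> \<sigma>)"
proof -
  have "(\<Sum>x\<in>matches (p @ [None]). if last0 x = \<sigma> then weight x else 0) =
      (\<Sum>x\<in>matches p. weight x * step_prob (length p) (last0 x) \<sigma>)"
    unfolding sum_matches_snoc_None using assms matchesD(2)
    by (intro sum.cong) (simp_all add: last0_def[of "_ @ [_]"] weight_snoc)
  then show ?thesis
    unfolding cond_def[of "_ @ _"] mass_snoc_None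
    by (simp only: sum_cond[where g = "\<lambda>\<tau>. step_prob (length p) \<tau> \<sigma>"])
qed

lemma cond_vec_snoc_None:
  assumes "\<sigma> < m" "q < n"
  shows "cond_vec (p @ [None]) \<sigma> q =
    (\<Sum>\<tau><m. \<Sum>q'<n. cond_vec p \<tau> q' * step_prob (length p) \<tau> \<sigma> * wa_mat A \<sigma> $$ (q', q))"
proof -
  have "(\<Sum>x\<in>matches (p @ [None]). if last0 x = \<sigma> then weight x * run_vec x q else 0) =
      (\<Sum>x\<in>matches p. weight (x @ [\<sigma>]) * run_vec (x @ [\<sigma>]) q)"
    unfolding sum_matches_snoc_None using assms matchesD(2)
    by (intro sum.cong) (simp_all add: last0_def[of "_ @ [_]"])
  then show ?thesis
    unfolding cond_vec_def[of "_ @ _"] mass_snoc_None by (simp only: sum_cond_vec_step[OF assms])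
qed

text \<open>For \<open>\<sigma> = b\<close> numerator and denominator coincide, and positivity of
  the mass excludes 0 / 0.\<close>

lemma cond_snoc_Some:
  assumes "b < m" "valid p"
  shows "cond (p @ [Some b]) \<sigma> = (if \<sigma> = b then 1 else 0)"
proof -
  have "mass (p @ [Some b]) \<noteq> 0"
    using mass_pos[of "p @ [Some b]"] assms by (simp add: valid_def)
  moreover have "mass (p @ [Some b]) = (\<Sum>x\<in>matches p. weight (x @ [b]))"
    using assms by (simp add: mass_def sum_matches_snoc_Some)
  ultimately show ?thesis
    using assms by (simp add: cond_def sum_matches_snoc_Some last0_def)
qed

text \<open>Numerator and new mass are both divided by the old mass, which cancels in the
  quotient.\<close>

lemma cond_vec_snoc_Some:
  assumes "b < m" "q < n" "valid p"
  shows "cond_vec (p @ [Some b]) \<sigma> q = (if \<sigma> = b then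
    (\<Sum>\<tau><m. \<Sum>q'<n. cond_vec p \<tau> q' * step_prob (length p) \<tau> b * wa_mat A b $$ (q', q)) /
      (\<Sum>\<tau><m. cond p \<tau> * step_prob (length p) \<tau> b) else 0)"
proof (cases "\<sigma> = b")
  case True
  have p: "mass p \<noteq> 0" using mass_pos[OF assms(3)] by simp
  have "(\<Sum>x\<in>matches (p @ [Some b]). if last0 x = \<sigma> then weight x * run_vec x q else 0) =
      (\<Sum>x\<in>matches p. weight (x @ [b]) * run_vec (x @ [b]) q)"
    using assms True by (simp add: sum_matches_snoc_Some last0_def)
  then show ?thesis
    unfolding cond_vec_def[of "_ @ _"] mass_snoc_Some[OF assms(1) p] using True
    by (simp flip: sum_cond_vec_step[OF assms(1,2)])
next
  case False
  then show ?thesis using assms by (simp add: cond_vec_def sum_matches_snoc_Some last0_def)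
qed

section \<open>The dynamic program\<close>

text \<open>For \<open>a \<le> c\<close>, the probability of \<sigma> at position \<open>c\<close>
  given that position \<open>a\<close> carries its symbol of \<open>w\<close>, or given the virtual
  start if \<open>a = 0\<close>. For \<open>a = Suc c\<close> the first summand vanishes by
  \<open>cond_table_zero\<close>; a sum in place of a case distinction suits a program that only
  adds.\<close>

primrec cond_table :: "nat \<Rightarrow> nat \<Rightarrow> nat \<Rightarrow> real" where
  "cond_table 0 a \<sigma> = (if a = 0 \<and> \<sigma> = 0 then 1 else 0)"
| "cond_table (Suc c) a \<sigma> = (\<Sum>\<tau><m. cond_table c a \<tau> * step_prob c \<tau> \<sigma>) +
     (if a = Suc c \<and> \<sigma> = w ! c then 1 else 0)"

lemma cond_table_zero: "c < a \<Longrightarrow> cond_table c a \<sigma> = 0"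
  by (induction c arbitrary: \<sigma>) auto

lemma prefix_patterns_valid:
  assumes "p \<in> prefix_patterns w c" "c \<le> L"
  shows "valid p"
  unfolding valid_def
proof
  fix x assume "x \<in> set p"
  then obtain k where "k < c" "x = p ! k"
    using assms(1) by (auto simp: prefix_patterns_def in_set_conv_nth)
  then show "x \<in> insert None (Some ` {..<m})"
    using assms w_less[of k] by (auto simp: prefix_patterns_def)
qed

text \<open>A wildcard sends both sides through one transition; a fixed symbol resets both to a
  point mass, whatever came before.\<close>

lemma cond_eq_table:
  assumes "p \<in> prefix_patterns w c" "c \<le> L" "\<sigma> < m"
  shows "cond p \<sigma> = cond_table c (last_fixed p) \<sigma>"
  using assms
proof (induction c arbitrary: p \<sigma>)
  case 0
  then show ?case by (simp add: prefix_patterns_0 cond_Nil)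
next
  case (Suc c)
  then obtain r where r: "r \<in> prefix_patterns w c"
    and p: "p = r @ [None] \<or> p = r @ [Some (w ! c)]"
    by (auto simp: prefix_patterns_Suc)
  have len: "length r = c" using r by (simp add: prefix_patterns_def)
  have le: "last_fixed r \<le> c" using last_fixed_le[of r] len by simp
  from p show ?case
  proof
    assume "p = r @ [None]"
    then show ?thesis using Suc.IH[OF r] Suc.prems le by (simp add: cond_snoc_None len)
  next
    assume "p = r @ [Some (w ! c)]"
    then show ?thesis
      using Suc.prems w_less[of c] prefix_patterns_valid[OF r]
      by (simp add: cond_snoc_Some len cond_table_zero)
  qed
qed

definition vec_table :: "nat \<Rightarrow> nat \<Rightarrow> nat \<Rightarrow> nat \<Rightarrow> nat \<Rightarrow> nat \<Rightarrow> real" where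
  "vec_table c e j a \<sigma> q = (\<Sum>p\<in>prefix_patterns w c.
     if wildcard_at i p = e \<and> count_list p None = j \<and> last_fixed p = a then cond_vec p \<sigma> q else 0)"

text \<open>The binomial coefficient \<open>c\<close> choose \<open>j\<close>, real-valued because
  it becomes a divisor.\<close>

definition count_table :: "nat \<Rightarrow> nat \<Rightarrow> real" where
  "count_table c j = (\<Sum>p\<in>prefix_patterns w c. if count_list p None = j then 1 else 0)"

lemma vec_table_0:
  "q < n \<Longrightarrow> vec_table 0 e j a \<sigma> q =
     (if e = 0 \<and> j = 0 \<and> a = 0 \<and> \<sigma> = 0 then vec_index (wa_alpha A) q else 0)"
  unfolding vec_table_def prefix_patterns_0 using i by (auto simp: cond_vec_Nil wildcard_at_Nil)

lemma count_table_0: "count_table 0 j = (if j = 0 then 1 else 0)"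
  by (auto simp: count_table_def prefix_patterns_0)

lemma sum_delta3:
  fixes X :: "nat \<Rightarrow> nat \<Rightarrow> nat \<Rightarrow> real"
  assumes "x < n1" "y < n2" "z < n3"
  shows "(\<Sum>e<n1. \<Sum>j<n2. \<Sum>a<n3. if x = e \<and> y = j \<and> z = a then X e j a else 0) = X x y z"
proof -
  have a: "(\<Sum>a<n3. if x = e \<and> y = j \<and> z = a then X e j a else 0) =
      (if x = e \<and> y = j then X e j z else 0)" for e j
    using assms by (cases "x = e \<and> y = j") auto
  have j: "(\<Sum>j<n2. if x = e \<and> y = j then X e j z else 0) = (if x = e then X e y z else 0)" for e
    using assms by (cases "x = e") auto
  show ?thesis using assms by (simp add: a j)
qed

text \<open>Each prefix lies in exactly one cell, and a factor that depends on the prefix only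
  through its cell can be applied to the cell as a whole. Both statistics are at most
  \<open>c \<le> L\<close>, so \<open>Suc L\<close> values suffice.\<close>

lemma sum_vec_table:
  assumes "c \<le> L"
  shows "(\<Sum>e<2. \<Sum>j<Suc L. \<Sum>a<Suc L. \<Sum>\<tau><m. \<Sum>q'<n.
      if Q e j a then vec_table c e j a \<tau> q' * K a \<tau> q' else 0) =
    (\<Sum>p\<in>prefix_patterns w c. if Q (wildcard_at i p) (count_list p None) (last_fixed p) then
      (\<Sum>\<tau><m. \<Sum>q'<n. cond_vec p \<tau> q' * K (last_fixed p) \<tau> q') else 0)"
    (is "?l = ?r")
proof -
  let ?pp = "prefix_patterns w c"
  let ?ft = "\<lambda>p e j a. wildcard_at i p = e \<and> count_list p None = j \<and> last_fixed p = a"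
  let ?X = "\<lambda>p e j a. if Q e j a then (\<Sum>\<tau><m. \<Sum>q'<n. cond_vec p \<tau> q' * K a \<tau> q') else 0"
  have "?r = (\<Sum>p\<in>?pp. \<Sum>e<2. \<Sum>j<Suc L. \<Sum>a<Suc L. if ?ft p e j a then ?X p e j a else 0)"
  proof (intro sum.cong refl)
    fix p assume "p \<in> ?pp"
    then have "length p \<le> L" using assms by (simp add: prefix_patterns_def)
    then have "count_list p None < Suc L" "last_fixed p < Suc L"
      using count_le_length[of p None] last_fixed_le[of p] by simp_all
    then show "?X p (wildcard_at i p) (count_list p None) (last_fixed p) =
        (\<Sum>e<2. \<Sum>j<Suc L. \<Sum>a<Suc L. if ?ft p e j a then ?X p e j a else 0)"
      by (simp only: sum_delta3[where X = "?X p"] wildcard_at_less)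
  qed
  also have "\<dots> = (\<Sum>e<2. \<Sum>j<Suc L. \<Sum>a<Suc L. \<Sum>p\<in>?pp. if ?ft p e j a then ?X p e j a else 0)"
    by (simp only: sum.swap[of _ _ ?pp])
  also have "\<dots> = ?l"
  proof (intro sum.cong refl)
    fix e j a
    have "(\<Sum>p\<in>?pp. if ?ft p e j a then (\<Sum>\<tau><m. \<Sum>q'<n. cond_vec p \<tau> q' * K a \<tau> q') else 0) =
        (\<Sum>p\<in>?pp. \<Sum>\<tau><m. \<Sum>q'<n. (if ?ft p e j a then cond_vec p \<tau> q' else 0) * K a \<tau> q')"
      by (intro sum.cong refl) auto
    also have "\<dots> = (\<Sum>\<tau><m. \<Sum>q'<n. vec_table c e j a \<tau> q' * K a \<tau> q')"
      unfolding vec_table_def sum_distrib_right by (simp only: sum.swap[of _ _ ?pp])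
    finally show "(\<Sum>p\<in>?pp. if ?ft p e j a then ?X p e j a else 0) =
        (\<Sum>\<tau><m. \<Sum>q'<n. if Q e j a then vec_table c e j a \<tau> q' * K a \<tau> q' else 0)"
      by (cases "Q e j a") (simp_all cong: if_cong)
  qed
  finally show ?thesis by simp
qed

text \<open>The first sum appends a wildcard, the second the symbol \<open>w ! c\<close>. Both run
  over the source cells and test for the target, as the loops of the program do. The wildcard flag
  rises exactly when the new position \<open>Suc c\<close> is \<open>i\<close>.\<close>

lemma vec_table_Suc:
  assumes "c < L" "\<sigma> < m" "q < n"
  shows "vec_table (Suc c) e' j' a' \<sigma> q =
    (\<Sum>e<2. \<Sum>j<Suc L. \<Sum>a<Suc L. \<Sum>\<tau><m. \<Sum>q'<n.
      if e' = e + (if i = Suc c then 1 else 0) \<and> j' = Suc j \<and> a' = a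
      then vec_table c e j a \<tau> q' * (step_prob c \<tau> \<sigma> * wa_mat A \<sigma> $$ (q', q)) else 0) +
    (\<Sum>e<2. \<Sum>j<Suc L. \<Sum>a<Suc L. \<Sum>\<tau><m. \<Sum>q'<n.
      if e' = e \<and> j' = j \<and> a' = Suc c \<and> \<sigma> = w ! c
      then vec_table c e j a \<tau> q' * (step_prob c \<tau> \<sigma> * wa_mat A \<sigma> $$ (q', q) /
        (\<Sum>\<tau><m. cond_table c a \<tau> * step_prob c \<tau> \<sigma>)) else 0)"
proof -
  have c: "c \<le> L" using assms by simp
  have len: "length p = c" if "p \<in> prefix_patterns w c" for p
    using that by (simp add: prefix_patterns_def)
  show ?thesis
    unfolding sum_vec_table[OF c, where K = "\<lambda>a \<tau> q'. step_prob c \<tau> \<sigma> * wa_mat A \<sigma> $$ (q', q)"]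
      sum_vec_table[OF c, where K = "\<lambda>a \<tau> q'. step_prob c \<tau> \<sigma> * wa_mat A \<sigma> $$ (q', q) /
        (\<Sum>\<tau><m. cond_table c a \<tau> * step_prob c \<tau> \<sigma>)"]
    unfolding vec_table_def[of "Suc c"] sum_prefix_patterns_Suc
  proof (intro arg_cong2[where f = "(+)"] sum.cong refl, goal_cases)
    case (1 p)
    then show ?case
      using assms i len[OF 1]
      by (auto simp: wildcard_at_snoc cond_vec_snoc_None mult.assoc)
  next
    case (2 p)
    have "(\<Sum>\<tau><m. cond p \<tau> * step_prob c \<tau> (w ! c)) =
        (\<Sum>\<tau><m. cond_table c (last_fixed p) \<tau> * step_prob c \<tau> (w ! c))"
      using cond_eq_table[OF 2 c] by (intro sum.cong) auto
    then show ?case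
      using assms i len[OF 2] w_less[of c] prefix_patterns_valid[OF 2 c]
      by (auto simp: wildcard_at_snoc cond_vec_snoc_Some mult.assoc sum_divide_distrib)
  qed
qed

text \<open>Pascal's rule, again summed over the source cells.\<close>

lemma count_table_Suc:
  assumes "c < L"
  shows "count_table (Suc c) j' =
    (\<Sum>j<Suc L. if j' = j then count_table c j else 0) +
    (\<Sum>j<Suc L. if j' = Suc j then count_table c j else 0)"
proof -
  have *: "(\<Sum>p\<in>prefix_patterns w c. if g (count_list p None) = j' then 1 else 0) =
      (\<Sum>j<Suc L. if j' = g j then count_table c j else 0)" for g :: "nat \<Rightarrow> nat"
  proof -
    have "(\<Sum>p\<in>prefix_patterns w c. if g (count_list p None) = j' then 1 else 0) =
        (\<Sum>p\<in>prefix_patterns w c. \<Sum>j<Suc L. if count_list p None = j then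
           (if j' = g j then 1 else 0) else (0::real))"
    proof (intro sum.cong refl)
      fix p assume "p \<in> prefix_patterns w c"
      then have "count_list p None < Suc L"
        using assms count_le_length[of p None] by (simp add: prefix_patterns_def)
      then show "(if g (count_list p None) = j' then 1 else 0) =
          (\<Sum>j<Suc L. if count_list p None = j then (if j' = g j then 1 else 0) else (0::real))"
        by (simp del: sum.lessThan_Suc)
    qed
    also have "\<dots> = (\<Sum>j<Suc L. \<Sum>p\<in>prefix_patterns w c. if count_list p None = j then
           (if j' = g j then 1 else 0) else (0::real))"
      by (rule sum.swap)
    also have "\<dots> = (\<Sum>j<Suc L. if j' = g j then count_table c j else 0)"
      unfolding count_table_def by (intro sum.cong refl) auto
    finally show ?thesis .
  qed
  show ?thesis
    unfolding count_table_def[of "Suc c"] sum_prefix_patterns_Suc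
    using *[of Suc] *[of "\<lambda>j. j"] by (simp del: sum.lessThan_Suc)
qed

section \<open>The SHAP score as a sum over the table\<close>

lemma pattern_value_eq:
  assumes "length p = L" "valid p"
  shows "pattern_value {..<m} p (wa_lang A) w P =
    (\<Sum>\<sigma><m. \<Sum>q<n. cond_vec p \<sigma> q * vec_index (wa_beta A) q)"
proof -
  have L: "1 \<le> L" using i by simp
  let ?M = "markov_pmf {..<m} P L"
  have pmf: "pmf ?M x = weight x" if "x \<in> matches p" for x
    using matchesD[OF that] L assms(1)
    by (auto simp: pmf_markov_pmf[OF P _ L] words_def weight_def)
  have mass: "0 < mass p" by (rule mass_pos) fact
  have prob: "measure_pmf.prob ?M (matches p) = mass p"
    using pmf by (simp add: measure_measure_pmf_finite mass_def)
  \<comment> \<open>\<open>cond_pmf\<close> is meaningful only if the event meets the support;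
    positive mass guarantees this.\<close>
  have ne: "set_pmf ?M \<inter> matches p \<noteq> {}"
    using prob mass by (auto simp flip: measure_pmf_zero_iff)
  have "pattern_value {..<m} p (wa_lang A) w P =
      (\<Sum>x\<in>matches p. wa_lang A x * pmf (cond_pmf ?M (matches p)) x)"
    unfolding pattern_value_def matches_def[symmetric]
    using ne by (intro integral_measure_pmf_real) auto
  also have "\<dots> = (\<Sum>x\<in>matches p. \<Sum>q<n. weight x * run_vec x q * vec_index (wa_beta A) q) / mass p"
    using matchesD(1) ne
    by (simp add: pmf_cond prob pmf wa_lang_eq sum_distrib_left sum_divide_distrib mult_ac)
  also have "(\<Sum>x\<in>matches p. \<Sum>q<n. weight x * run_vec x q * vec_index (wa_beta A) q) =
      (\<Sum>q<n. \<Sum>x\<in>matches p. weight x * run_vec x q * vec_index (wa_beta A) q)"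
    by (rule sum.swap)
  also have "\<dots> / mass p =
      (\<Sum>q<n. (\<Sum>x\<in>matches p. weight x * run_vec x q * vec_index (wa_beta A) q) / mass p)"
    by (rule sum_divide_distrib)
  also have "\<dots> = (\<Sum>q<n. \<Sum>\<sigma><m. cond_vec p \<sigma> q * vec_index (wa_beta A) q)"
    by (intro sum.cong refl sum_cond_vec[where g = "\<lambda>_. vec_index (wa_beta A) q" for q])
  also have "\<dots> = (\<Sum>\<sigma><m. \<Sum>q<n. cond_vec p \<sigma> q * vec_index (wa_beta A) q)"
    by (rule sum.swap)
  finally show ?thesis .
qed

section \<open>Classes of full-length patterns and the effect of \<open>swap\<close>\<close>

definition pat_value :: "nat option list \<Rightarrow> real" where
  "pat_value p = pattern_value {..<m} p (wa_lang A) w P"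

definition pattern_class :: "nat \<Rightarrow> nat \<Rightarrow> nat option list set" where
  "pattern_class e j = {p \<in> prefix_patterns w L. wildcard_at i p = e \<and> count_list p None = j}"

text \<open>The last fixed position serves the recursion alone; at full length it is summed
  out.\<close>

lemma sum_pattern_class:
  "(\<Sum>p\<in>pattern_class e j. pat_value p) =
    (\<Sum>\<sigma><m. \<Sum>q<n. \<Sum>a<Suc L. vec_table L e j a \<sigma> q * vec_index (wa_beta A) q)"
proof -
  let ?pp = "prefix_patterns w L"
  have "(\<Sum>a<Suc L. vec_table L e j a \<sigma> q) =
      (\<Sum>p\<in>pattern_class e j. cond_vec p \<sigma> q)" for \<sigma> q
  proof -
    have "(\<Sum>a<Suc L. vec_table L e j a \<sigma> q) = (\<Sum>p\<in>?pp. \<Sum>a<Suc L.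
        if last_fixed p = a then (if wildcard_at i p = e \<and> count_list p None = j
          then cond_vec p \<sigma> q else 0) else 0)"
      unfolding vec_table_def by (subst sum.swap) (intro sum.cong refl, auto)
    also have "\<dots> = (\<Sum>p\<in>?pp. if wildcard_at i p = e \<and> count_list p None = j
          then cond_vec p \<sigma> q else 0)"
    proof (intro sum.cong refl)
      fix p assume "p \<in> ?pp"
      then have "last_fixed p < Suc L"
        using last_fixed_le[of p] by (simp add: prefix_patterns_def)
      then show "(\<Sum>a<Suc L. if last_fixed p = a then (if wildcard_at i p = e \<and> count_list p None = j
          then cond_vec p \<sigma> q else 0) else 0) = (if wildcard_at i p = e \<and> count_list p None = j
          then cond_vec p \<sigma> q else 0)"
        by (simp del: sum.lessThan_Suc)
    qed
    finally show ?thesis by (simp add: pattern_class_def sum.inter_filter)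
  qed
  then have "(\<Sum>\<sigma><m. \<Sum>q<n. \<Sum>a<Suc L. vec_table L e j a \<sigma> q * vec_index (wa_beta A) q) =
      (\<Sum>\<sigma><m. \<Sum>q<n. \<Sum>p\<in>pattern_class e j. cond_vec p \<sigma> q * vec_index (wa_beta A) q)"
    by (simp only: sum_distrib_right[symmetric])
  also have "\<dots> = (\<Sum>p\<in>pattern_class e j. \<Sum>\<sigma><m. \<Sum>q<n. cond_vec p \<sigma> q * vec_index (wa_beta A) q)"
    by (simp only: sum.swap[of _ _ "pattern_class e j"])
  also have "\<dots> = (\<Sum>p\<in>pattern_class e j. pat_value p)"
    unfolding pat_value_def
    by (intro sum.cong refl pattern_value_eq[symmetric] prefix_patterns_valid[of _ L])
      (auto simp: pattern_class_def prefix_patterns_def)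
  finally show ?thesis by simp
qed

lemma count_list_update:
  assumes "k < length p" "p ! k \<noteq> x"
  shows "count_list (p[k := x]) x = Suc (count_list p x)"
proof -
  have "count_list p x = count_list (take k p @ p ! k # drop (Suc k) p) x"
    using assms(1) by (simp add: id_take_nth_drop[symmetric])
  then show ?thesis using assms by (simp add: upd_conv_take_nth_drop)
qed

lemma sum_swap_class: "(\<Sum>p\<in>pattern_class 0 j. pat_value (swap p i)) = (\<Sum>p\<in>pattern_class 1 (Suc j). pat_value p)"
\<comment> \<open>The inverse restores \<open>w ! (i - 1)\<close>, the only fixed symbol that a
  pattern matching \<open>w\<close> can have there.\<close>
proof (rule sum.reindex_bij_witness[where i = "\<lambda>p. p[i - 1 := Some (w ! (i - 1))]"
    and j = "\<lambda>p. swap p i"])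
  fix p assume p: "p \<in> pattern_class 0 j"
  then have len: "length p = L" and "wildcard_at i p = 0"
    by (simp_all add: pattern_class_def prefix_patterns_def)
  then have fixed: "p ! (i - 1) \<noteq> None" using i by (simp add: wildcard_at_def split: if_splits)
  have "p ! (i - 1) = None \<or> p ! (i - 1) = Some (w ! (i - 1))"
    using p i by (simp add: pattern_class_def prefix_patterns_def)
  with fixed have "p ! (i - 1) = Some (w ! (i - 1))" by metis
  then show "(swap p i)[i - 1 := Some (w ! (i - 1))] = p"
    by (metis list_update_id list_update_overwrite swap_def)
  have "count_list (swap p i) None = Suc j"
    using count_list_update[of "i - 1" p None] p i len fixed by (simp add: swap_def pattern_class_def)
  moreover have "swap p i \<in> prefix_patterns w L"
    using p by (simp add: swap_def pattern_class_def list_update_prefix_patterns)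
  moreover have "wildcard_at i (swap p i) = 1"
    using i len by (simp add: swap_def wildcard_at_def)
  ultimately show "swap p i \<in> pattern_class 1 (Suc j)"
    by (simp add: pattern_class_def)
next
  fix p assume p: "p \<in> pattern_class 1 (Suc j)"
  then have len: "length p = L" and "wildcard_at i p = 1"
    by (simp_all add: pattern_class_def prefix_patterns_def)
  then have none: "p ! (i - 1) = None" by (metis wildcard_at_def zero_neq_one)
  let ?r = "p[i - 1 := Some (w ! (i - 1))]"
  show r: "swap ?r i = p"
    using none by (metis list_update_id list_update_overwrite swap_def)
  have "count_list (?r[i - 1 := None]) None = Suc (count_list ?r None)"
    using i len by (intro count_list_update) simp_all
  then have "count_list ?r None = j"
    using r p by (simp add: swap_def pattern_class_def)
  moreover have "?r \<in> prefix_patterns w L"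
    using p by (simp add: pattern_class_def list_update_prefix_patterns)
  moreover have "wildcard_at i ?r = 0"
    using i len by (simp add: wildcard_at_def)
  ultimately show "?r \<in> pattern_class 0 j"
    by (simp add: pattern_class_def)
qed simp

lemma sum_patterns_difference:
  "(\<Sum>p\<in>patterns {..<m} w j. pat_value p - pat_value (swap p i)) =
    (\<Sum>p\<in>pattern_class 0 j. pat_value p) - (\<Sum>p\<in>pattern_class 1 (Suc j). pat_value p)"
proof -
  have "(\<Sum>p\<in>patterns {..<m} w j. pat_value p - pat_value (swap p i)) =
      (\<Sum>p\<in>pattern_class 0 j. pat_value p - pat_value (swap p i))"
  proof (rule sum.mono_neutral_right)
    show "finite (patterns {..<m} w j)" by (simp add: patterns_eq[OF w])
    show "pattern_class 0 j \<subseteq> patterns {..<m} w j" by (auto simp: patterns_eq[OF w] pattern_class_def)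
    have "swap p i = p" if "p \<in> patterns {..<m} w j - pattern_class 0 j" for p
    proof -
      have "p ! (i - 1) = None"
        using that by (auto simp: patterns_eq[OF w] pattern_class_def wildcard_at_def split: if_splits)
      then show ?thesis by (metis list_update_id swap_def)
    qed
    then show "\<forall>p\<in>patterns {..<m} w j - pattern_class 0 j. pat_value p - pat_value (swap p i) = 0" by simp
  qed
  then show ?thesis by (simp add: sum_subtractf sum_swap_class)
qed

lemma card_patterns: "real (card (patterns {..<m} w j)) = count_table L j"
proof -
  have "real (card {p \<in> prefix_patterns w L. count_list p None = j}) =
      (\<Sum>p\<in>{p \<in> prefix_patterns w L. count_list p None = j}. 1)" by simp
  then show ?thesis
    unfolding patterns_eq[OF w] count_table_def by (simp only: sum.inter_filter finite_prefix_patterns)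
qed

text \<open>Makes the uniform distribution in the score a genuine one, so that its expectation is an
  average.\<close>

lemma patterns_nonempty:
  assumes "j \<le> L"
  shows "patterns {..<m} w j \<noteq> {}"
proof -
  let ?p = "replicate j None @ map Some (drop j w)"
  have "count_list (map Some v) None = 0" for v :: "nat list"
    by (induction v) auto
  moreover have "count_list (replicate j None) (None :: nat option) = j"
    by (induction j) auto
  ultimately have "?p \<in> patterns {..<m} w j"
    using assms by (auto simp: patterns_eq[OF w] prefix_patterns_def nth_append)
  then show ?thesis by blast
qed

text \<open>All factors are moved inside the innermost sum, since the program accumulates the score
  in a single cell. The index \<open>j\<close> is one less than the number of wildcards.\<close>

lemma shap_eq:
  "shap {..<m} (wa_lang A) w i P =
    (\<Sum>j<L - 1. \<Sum>\<sigma><m. \<Sum>q<n. \<Sum>a<Suc L.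
      (vec_table L 0 (Suc j) a \<sigma> q - vec_table L 1 (Suc (Suc j)) a \<sigma> q) *
        vec_index (wa_beta A) q / (real (Suc j) * count_table L (Suc j)))"
proof -
  have E: "measure_pmf.expectation (pmf_of_set (patterns {..<m} w (L - k)))
          (\<lambda>p. pat_value p - pat_value (swap p i)) =
      (\<Sum>p\<in>patterns {..<m} w (L - k). pat_value p - pat_value (swap p i)) / count_table L (L - k)" for k
  proof -
    have "finite (patterns {..<m} w (L - k))" by (simp add: patterns_eq[OF w])
    then show ?thesis by (simp add: integral_pmf_of_set patterns_nonempty card_patterns)
  qed
  have "shap {..<m} (wa_lang A) w i P = (\<Sum>k=1..L - 1. 1 / real (L - k) *
      ((\<Sum>p\<in>patterns {..<m} w (L - k). pat_value p - pat_value (swap p i)) / count_table L (L - k)))"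
    unfolding shap_def pat_value_def[symmetric] E by (rule refl)
  also have "\<dots> = (\<Sum>j<L - 1. 1 / real (Suc j) *
      ((\<Sum>p\<in>patterns {..<m} w (Suc j). pat_value p - pat_value (swap p i)) / count_table L (Suc j)))"
    \<comment> \<open>Substituting \<open>k = L - Suc j\<close> gives \<open>L - k = Suc j\<close>
      and removes the subtraction from the table indices.\<close>
    by (rule sum.reindex_bij_witness[of _ "\<lambda>j. L - Suc j" "\<lambda>k. L - Suc k"])
      (auto simp: Suc_diff_Suc)
  also have "\<dots> = (\<Sum>j<L - 1. \<Sum>\<sigma><m. \<Sum>q<n. \<Sum>a<Suc L.
      (vec_table L 0 (Suc j) a \<sigma> q - vec_table L 1 (Suc (Suc j)) a \<sigma> q) *
        vec_index (wa_beta A) q / (real (Suc j) * count_table L (Suc j)))"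
    unfolding sum_patterns_difference sum_pattern_class
    by (simp only: sum_subtractf[symmetric] left_diff_distrib[symmetric] sum_divide_distrib[symmetric]
      times_divide_times_eq mult_1)
  finally show ?thesis .
qed

end

section \<open>The program\<close>

abbreviation "nsucc x \<equiv> NAdd (nvar x) (NConst 1)"

text \<open>Every row gets the initial distribution, matching \<open>step_prob 0\<close>, which
  ignores its source symbol.\<close>

definition add_trans :: com where
  "add_trans =
     for_loop ''s'' (nvar ''alphabet'') (for_loop ''t'' (nvar ''alphabet'')
       (add_cell ''P'' [nvar ''s'', nvar ''t''] (RCell ''init'' [nvar ''t''])))"

definition add_alpha :: com where
  "add_alpha =
     for_loop ''q'' (nvar ''size'')
       (add_cell ''D'' [NConst 0, NConst 0, NConst 0, NConst 0, NConst 0, nvar ''q'']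
         (RCell ''alpha'' [nvar ''q'']))"

definition add_cond :: com where
  "add_cond =
     for_loop ''a'' (nsucc ''length'') (for_loop ''t'' (nvar ''alphabet'')
     (for_loop ''s'' (nvar ''alphabet'')
       (add_cell ''Z'' [nsucc ''c'', nvar ''a'', nvar ''t'']
         (RMul (RCell ''Z'' [nvar ''c'', nvar ''a'', nvar ''s''])
           (RCell ''P'' [nvar ''s'', nvar ''t''])))))"

text \<open>With truncated subtraction, \<open>1 - ((c + 1 - i) + (i - (c + 1)))\<close> is the indicator of
  \<open>i = c + 1\<close>.\<close>

definition add_wildcard :: com where
  "add_wildcard =
     for_loop ''t'' (nvar ''alphabet'') (for_loop ''q'' (nvar ''size'')
     (for_loop ''e'' (NConst 2) (for_loop ''j'' (nsucc ''length'') (for_loop ''a'' (nsucc ''length'')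
     (for_loop ''s'' (nvar ''alphabet'') (for_loop ''p'' (nvar ''size'')
       (add_cell ''D''
         [nsucc ''c'',
          NAdd (nvar ''e'') (NSub (NConst 1)
            (NAdd (NSub (nsucc ''c'') (nvar ''i'')) (NSub (nvar ''i'') (nsucc ''c'')))),
          nsucc ''j'', nvar ''a'', nvar ''t'', nvar ''q'']
         (RMul (RCell ''D'' [nvar ''c'', nvar ''e'', nvar ''j'', nvar ''a'', nvar ''s'', nvar ''p''])
           (RMul (RCell ''P'' [nvar ''s'', nvar ''t''])
             (RCell ''A'' [nvar ''t'', nvar ''p'', nvar ''q'']))))))))))"

abbreviation "cur_symbol \<equiv> NCell ''w'' [nvar ''c'']"

text \<open>For \<open>a > c\<close> the divisor cell is 0 and the quotient has the default value 0;
  this is harmless because the factor read from \<open>D\<close> is 0 there as well.\<close>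

definition add_fixed :: com where
  "add_fixed =
     for_loop ''q'' (nvar ''size'')
     (for_loop ''e'' (NConst 2) (for_loop ''j'' (nsucc ''length'') (for_loop ''a'' (nsucc ''length'')
     (for_loop ''s'' (nvar ''alphabet'') (for_loop ''p'' (nvar ''size'')
       (add_cell ''D''
         [nsucc ''c'', nvar ''e'', nvar ''j'', nsucc ''c'', cur_symbol, nvar ''q'']
         (RMul (RCell ''D'' [nvar ''c'', nvar ''e'', nvar ''j'', nvar ''a'', nvar ''s'', nvar ''p''])
           (RDiv (RMul (RCell ''P'' [nvar ''s'', cur_symbol])
                       (RCell ''A'' [cur_symbol, nvar ''p'', nvar ''q'']))
             (RCell ''Z'' [nsucc ''c'', nvar ''a'', cur_symbol])))))))))"

definition add_count :: "nexp \<Rightarrow> com" where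
  "add_count e = for_loop ''j'' (nsucc ''length'')
     (add_cell ''B'' [nsucc ''c'', e] (RCell ''B'' [nvar ''c'', nvar ''j'']))"

text \<open>The point mass is added to \<open>Z\<close> only after \<open>add_fixed\<close>, whose
  divisors are the bare sums left by \<open>add_cond\<close>. The two calls of
  \<open>add_count\<close> are the two terms of Pascal's rule. \<open>R\<close> counts in reals, as
  naturals cannot be converted. The final call replaces \<open>P\<close> by the transition out of
  the next position.\<close>

definition position_step :: com where
  "position_step =
     Seq add_cond (Seq add_wildcard (Seq add_fixed
     (Seq (add_cell ''Z'' [nsucc ''c'', nsucc ''c'', cur_symbol] (RConst 1))
     (Seq (add_count (nvar ''j'')) (Seq (add_count (nsucc ''j''))
     (Seq (add_cell ''R'' [nsucc ''c''] (RAdd (RCell ''R'' [nvar ''c'']) (RConst 1)))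
       (Call ''P'' (nsucc ''c''))))))))"

definition add_out :: com where
  "add_out =
     for_loop ''j'' (NSub (nvar ''length'') (NConst 1)) (for_loop ''t'' (nvar ''alphabet'')
     (for_loop ''q'' (nvar ''size'') (for_loop ''a'' (nsucc ''length'')
       (add_cell ''out'' []
         (RDiv
           (RMul
             (RSub
               (RCell ''D'' [nvar ''length'', NConst 0, nsucc ''j'', nvar ''a'', nvar ''t'', nvar ''q''])
               (RCell ''D'' [nvar ''length'', NConst 1, NAdd (nvar ''j'') (NConst 2), nvar ''a'',
                  nvar ''t'', nvar ''q'']))
             (RCell ''beta'' [nvar ''q'']))
           (RMul (RCell ''R'' [nsucc ''j'']) (RCell ''B'' [nvar ''length'', nsucc ''j''])))))))"

definition init_tables :: com where
  "init_tables =
     Seq add_trans (Seq add_alpha (Seq (add_cell ''Z'' [NConst 0, NConst 0, NConst 0] (RConst 1))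
       (add_cell ''B'' [NConst 0, NConst 0] (RConst 1))))"

definition shap_prog :: com where
  "shap_prog =
     Seq init_tables (Seq (for_loop ''c'' (nvar ''length'') position_step) add_out)"

lemma real_consts_shap_prog: "real_consts shap_prog \<subseteq> \<rat>"
  by (simp add: shap_prog_def init_tables_def position_step_def add_trans_def add_alpha_def add_cond_def
    add_wildcard_def add_fixed_def add_count_def add_out_def for_loop_def add_cell_def)

text \<open>The outer counter \<open>c\<close> is left out, since every piece of a step must
  preserve it.\<close>

definition counters :: "string set" where
  "counters = {''a'', ''e'', ''j'', ''p'', ''q'', ''s'', ''t''}"

text \<open>The read-only cells of step \<open>c\<close>; its writes go to layer
  \<open>Suc c\<close>.\<close>

definition layer :: "nat \<Rightarrow> nat list set" where
  "layer c = range (Cons c)"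

lemma sum_pick:
  fixes f :: "nat \<Rightarrow> real"
  assumes "k < N" "\<And>l. l \<noteq> k \<Longrightarrow> f l = 0"
  shows "(\<Sum>l<N. f l) = f k"
  using assms by (subst sum.remove[of _ k]) auto

lemma nested_time:
  fixes x :: nat
  shows "x * (x * 100) \<le> 100 * x ^ 2"
    and "x * (x * (x * 100)) \<le> 100 * x ^ 3"
    and "x * (x * (x * (x * 100))) \<le> 100 * x ^ 4"
    and "x * (x * (x * (x * (x * (x * 100))))) \<le> 100 * x ^ 6"
    and "x * (x * (x * (x * (x * (x * (x * 100)))))) \<le> 100 * x ^ 7"
  by (simp_all add: power_numeral_reduce)

section \<open>Effect and cost of the single loop nests\<close>

context shap_instance
begin

text \<open>Strictly above every loop bound, the largest of which are \<open>n\<close>,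
  \<open>m\<close> and \<open>Suc L\<close>.\<close>

definition bd :: nat where
  "bd = n + L + m + 2"

text \<open>100 bounds one innermost addition, \<open>13 * bd\<close> is the factor per loop, and 7
  is the depth of the deepest nest, in \<open>add_wildcard\<close>.\<close>

definition step_time :: nat where
  "step_time = 100 * (13 * bd) ^ 7"

text \<open>\<open>adds\<close> for the current state only, with the protected cells and the
  individual time bound forgotten, so that pieces can be chained.\<close>

definition adding ::
  "(nat \<Rightarrow> nat \<Rightarrow> (nat list \<Rightarrow> real) \<Rightarrow> bool) \<Rightarrow> com \<Rightarrow> state \<Rightarrow> string \<Rightarrow> (nat list \<Rightarrow> real) \<Rightarrow> bool" where
  "adding proc c s y G \<longleftrightarrow> (\<exists>t s'. exec proc c s t s' \<and> t \<le> step_time \<and> same_nmem counters s s' \<and>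
     rmem s' = (rmem s)(y := (\<lambda>js. rmem s y js + G js)))"

lemma addingI:
  assumes "adds proc c s X y W G T" "X \<subseteq> counters" "T \<le> 100 * (13 * bd) ^ k" "k \<le> 7"
  shows "adding proc c s y G"
proof -
  have "agree X y W s s" by (simp add: agree_def same_nmem_def)
  with assms(1) obtain t s' where s': "exec proc c s t s'" "t \<le> T" "same_nmem X s s'"
    "rmem s' = (rmem s)(y := (\<lambda>js. rmem s y js + G js))" by (auto simp: adds_def)
  have "(13 * bd) ^ k \<le> (13 * bd) ^ 7" using assms(4) by (intro power_increasing) (simp_all add: bd_def)
  then have "100 * (13 * bd) ^ k \<le> step_time" unfolding step_time_def by (rule mult_le_mono2)
  then have "t \<le> step_time" using s'(2) assms(3) by linarith
  moreover have "same_nmem counters s s'" using s'(3) assms(2) by (auto simp: same_nmem_def)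
  ultimately show ?thesis using s' by (auto simp: adding_def)
qed

definition inputs :: "state \<Rightarrow> bool" where
  "inputs s \<longleftrightarrow> nmem s ''alphabet'' [] = m \<and> nmem s ''size'' [] = n \<and> nmem s ''length'' [] = L \<and>
     nmem s ''i'' [] = i \<and> (\<forall>k<L. nmem s ''w'' [k] = w ! k) \<and>
     (\<forall>q<n. rmem s ''beta'' [q] = vec_index (wa_beta A) q) \<and>
     (\<forall>\<sigma><m. \<forall>q<n. \<forall>q'<n. rmem s ''A'' [\<sigma>, q, q'] = wa_mat A \<sigma> $$ (q, q'))"

lemma inputs_adding:
  assumes "inputs s" "same_nmem counters s s'" "rmem s' = (rmem s)(y := Y)" "y \<notin> {''A'', ''beta''}"
  shows "inputs s'"
  using assms by (auto simp: inputs_def same_nmem_def counters_def)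

lemmas adds_simps = bd_def inputs_def agree_def same_nmem_def nupdate_def layer_def

lemma adding_trans:
  assumes "nmem s ''alphabet'' [] = m"
  shows "adding proc add_trans s ''P''
    (\<lambda>js. \<Sum>\<sigma><m. \<Sum>\<tau><m. if js = [\<sigma>, \<tau>] then rmem s ''init'' [\<tau>] else 0)"
proof (rule addingI)
  show "adds proc add_trans s {''s'', ''t''} ''P'' {}
      (\<lambda>js. \<Sum>\<sigma><m. \<Sum>\<tau><m. if js = [\<sigma>, \<tau>] then rmem s ''init'' [\<tau>] else 0)
      (13 * bd * (13 * bd * 100))"
    unfolding add_trans_def
    \<comment> \<open>The stated increment has one sum per loop, in the order of the nest, so the
      two rules apply syntactically and leave only side conditions.\<close>
    by (intro adds_for_loop adds_add_cell) (use assms in \<open>auto simp: adds_simps\<close>)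
  show "13 * bd * (13 * bd * 100) \<le> 100 * (13 * bd) ^ 2" by (rule nested_time)
qed (auto simp: counters_def)

lemma adding_alpha:
  assumes "nmem s ''size'' [] = n"
  shows "adding proc add_alpha s ''D''
    (\<lambda>js. \<Sum>q<n. if js = [0, 0, 0, 0, 0, q] then rmem s ''alpha'' [q] else 0)"
proof (rule addingI)
  show "adds proc add_alpha s {''q''} ''D'' {}
      (\<lambda>js. \<Sum>q<n. if js = [0, 0, 0, 0, 0, q] then rmem s ''alpha'' [q] else 0)
      (13 * bd * 100)"
    unfolding add_alpha_def
    by (intro adds_for_loop adds_add_cell) (use assms in \<open>auto simp: adds_simps\<close>)
  show "13 * bd * 100 \<le> 100 * (13 * bd) ^ 1" by simp
qed (auto simp: counters_def)

lemma adding_cell: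
  assumes "reval e s = v" "map (\<lambda>e. neval e s) es = ks"
    and "\<And>s'. agree {} y {js. js \<noteq> ks} s s' \<Longrightarrow> reval e s' = reval e s"
    and "3 + 2 * sum_list (map ncost es) + rcost e \<le> 100"
  shows "adding proc (add_cell y es e) s y (\<lambda>js. if js = ks then v else 0)"
proof (rule addingI)
  \<comment> \<open>Without a loop around it, everything except the written cell can be
    protected.\<close>
  show "adds proc (add_cell y es e) s {} y {js. js \<noteq> ks} (\<lambda>js. if js = ks then v else 0) 100"
    using assms by (intro adds_add_cell) auto
  show "100 \<le> 100 * (13 * bd) ^ 0" by simp
qed auto

lemma adding_cond:
  assumes "inputs s" "nmem s ''c'' [] = c"
  shows "adding proc add_cond s ''Z'' (\<lambda>js. \<Sum>a<Suc L. \<Sum>\<tau><m. \<Sum>\<sigma><m.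
    if js = [Suc c, a, \<tau>] then rmem s ''Z'' [c, a, \<sigma>] * rmem s ''P'' [\<sigma>, \<tau>] else 0)"
proof (rule addingI)
  show "adds proc add_cond s {''a'', ''t'', ''s''} ''Z'' (layer c)
      (\<lambda>js. \<Sum>a<Suc L. \<Sum>\<tau><m. \<Sum>\<sigma><m.
        if js = [Suc c, a, \<tau>] then rmem s ''Z'' [c, a, \<sigma>] * rmem s ''P'' [\<sigma>, \<tau>] else 0)
      (13 * bd * (13 * bd * (13 * bd * 100)))"
    unfolding add_cond_def
    by (intro adds_for_loop adds_add_cell) (use assms in \<open>auto simp: adds_simps\<close>)
  show "13 * bd * (13 * bd * (13 * bd * 100)) \<le> 100 * (13 * bd) ^ 3"
    by (rule nested_time)
qed (auto simp: counters_def)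

definition wildcard_incr :: "state \<Rightarrow> nat \<Rightarrow> nat list \<Rightarrow> real" where
  "wildcard_incr s c = (\<lambda>js. \<Sum>\<sigma><m. \<Sum>q<n. \<Sum>e<2. \<Sum>j<Suc L. \<Sum>a<Suc L. \<Sum>\<tau><m. \<Sum>q'<n.
     if js = [Suc c, e + (if i = Suc c then 1 else 0), Suc j, a, \<sigma>, q]
     then rmem s ''D'' [c, e, j, a, \<tau>, q'] * (rmem s ''P'' [\<tau>, \<sigma>] * rmem s ''A'' [\<sigma>, q', q]) else 0)"

definition fixed_incr :: "state \<Rightarrow> nat \<Rightarrow> nat list \<Rightarrow> real" where
  "fixed_incr s c = (\<lambda>js. \<Sum>q<n. \<Sum>e<2. \<Sum>j<Suc L. \<Sum>a<Suc L. \<Sum>\<tau><m. \<Sum>q'<n.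
     if js = [Suc c, e, j, Suc c, w ! c, q]
     then rmem s ''D'' [c, e, j, a, \<tau>, q'] * (rmem s ''P'' [\<tau>, w ! c] * rmem s ''A'' [w ! c, q', q] /
       rmem s ''Z'' [Suc c, a, w ! c]) else 0)"

lemma adding_wildcard:
  assumes "inputs s" "nmem s ''c'' [] = c"
  shows "adding proc add_wildcard s ''D'' (wildcard_incr s c)"
proof (rule addingI)
  show "adds proc add_wildcard s {''t'', ''q'', ''e'', ''j'', ''a'', ''s'', ''p''} ''D'' (layer c)
      (wildcard_incr s c)
      (13 * bd * (13 * bd * (13 * bd * (13 * bd * (13 * bd * (13 * bd * (13 * bd * 100)))))))"
    unfolding add_wildcard_def wildcard_incr_def
    by (intro adds_for_loop adds_add_cell) (use assms in \<open>auto simp: adds_simps\<close>)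
  show "13 * bd * (13 * bd * (13 * bd * (13 * bd * (13 * bd * (13 * bd * (13 * bd * 100))))))
      \<le> 100 * (13 * bd) ^ 7" by (rule nested_time)
qed (auto simp: counters_def)

lemma adding_fixed:
  assumes "inputs s" "nmem s ''c'' [] = c" "c < L"
  shows "adding proc add_fixed s ''D'' (fixed_incr s c)"
proof (rule addingI)
  show "adds proc add_fixed s {''q'', ''e'', ''j'', ''a'', ''s'', ''p''} ''D'' (layer c)
      (fixed_incr s c)
      (13 * bd * (13 * bd * (13 * bd * (13 * bd * (13 * bd * (13 * bd * 100))))))"
    unfolding add_fixed_def fixed_incr_def
    by (intro adds_for_loop adds_add_cell) (use assms in \<open>auto simp: adds_simps\<close>)
  show "13 * bd * (13 * bd * (13 * bd * (13 * bd * (13 * bd * (13 * bd * 100)))))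
      \<le> 100 * (13 * bd) ^ 6" by (rule nested_time)
qed (auto simp: counters_def)

lemma adding_count:
  assumes "inputs s" "nmem s ''c'' [] = c"
  shows "adding proc (add_count (nvar ''j'')) s ''B''
      (\<lambda>js. \<Sum>j<Suc L. if js = [Suc c, j] then rmem s ''B'' [c, j] else 0)"
    and "adding proc (add_count (nsucc ''j'')) s ''B''
      (\<lambda>js. \<Sum>j<Suc L. if js = [Suc c, Suc j] then rmem s ''B'' [c, j] else 0)"
proof -
  have le: "13 * bd * 100 \<le> 100 * (13 * bd) ^ 1" by simp
  have "adds proc (add_count (nvar ''j'')) s {''j''} ''B'' (layer c)
      (\<lambda>js. \<Sum>j<Suc L. if js = [Suc c, j] then rmem s ''B'' [c, j] else 0) (13 * bd * 100)"
    unfolding add_count_def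
    by (intro adds_for_loop adds_add_cell) (use assms in \<open>auto simp: adds_simps\<close>)
  from addingI[OF this _ le]
  show "adding proc (add_count (nvar ''j'')) s ''B''
      (\<lambda>js. \<Sum>j<Suc L. if js = [Suc c, j] then rmem s ''B'' [c, j] else 0)"
    by (simp add: counters_def)
  have "adds proc (add_count (nsucc ''j'')) s {''j''} ''B'' (layer c)
      (\<lambda>js. \<Sum>j<Suc L. if js = [Suc c, Suc j] then rmem s ''B'' [c, j] else 0) (13 * bd * 100)"
    unfolding add_count_def
    by (intro adds_for_loop adds_add_cell) (use assms in \<open>auto simp: adds_simps\<close>)
  from addingI[OF this _ le]
  show "adding proc (add_count (nsucc ''j'')) s ''B''
      (\<lambda>js. \<Sum>j<Suc L. if js = [Suc c, Suc j] then rmem s ''B'' [c, j] else 0)"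
    by (simp add: counters_def)
qed

lemma adding_out:
  assumes "inputs s"
  shows "adding proc add_out s ''out'' (\<lambda>js. \<Sum>j<L - 1. \<Sum>\<sigma><m. \<Sum>q<n. \<Sum>a<Suc L.
    if js = [] then (rmem s ''D'' [L, 0, Suc j, a, \<sigma>, q] - rmem s ''D'' [L, 1, Suc (Suc j), a, \<sigma>, q]) *
      rmem s ''beta'' [q] / (rmem s ''R'' [Suc j] * rmem s ''B'' [L, Suc j]) else 0)"
proof (rule addingI)
  show "adds proc add_out s {''j'', ''t'', ''q'', ''a''} ''out'' {}
      (\<lambda>js. \<Sum>j<L - 1. \<Sum>\<sigma><m. \<Sum>q<n. \<Sum>a<Suc L.
    if js = [] then (rmem s ''D'' [L, 0, Suc j, a, \<sigma>, q] - rmem s ''D'' [L, 1, Suc (Suc j), a, \<sigma>, q]) *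
      rmem s ''beta'' [q] / (rmem s ''R'' [Suc j] * rmem s ''B'' [L, Suc j]) else 0)
      (13 * bd * (13 * bd * (13 * bd * (13 * bd * 100))))"
    unfolding add_out_def
    by (intro adds_for_loop adds_add_cell) (use assms in \<open>auto simp: adds_simps\<close>)
  show "13 * bd * (13 * bd * (13 * bd * (13 * bd * 100))) \<le> 100 * (13 * bd) ^ 4"
    by (rule nested_time)
qed (auto simp: counters_def)

text \<open>\<open>P\<close> holds the transition out of position \<open>c\<close>. Layers beyond
  \<open>c\<close> must still be 0 because the program adds to cells without clearing them. The
  claim on \<open>D\<close> has no range conditions on \<open>e\<close>, \<open>j\<close>,
  \<open>a\<close>: targets such as \<open>Suc j\<close> may leave the range of the loops.\<close>

definition progress :: "nat \<Rightarrow> state \<Rightarrow> bool" where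
  "progress c s \<longleftrightarrow> inputs s \<and>
     (\<forall>\<sigma><m. \<forall>\<tau><m. rmem s ''P'' [\<sigma>, \<tau>] = step_prob c \<sigma> \<tau>) \<and>
     (\<forall>e j a. \<forall>\<sigma><m. \<forall>q<n. rmem s ''D'' [c, e, j, a, \<sigma>, q] = vec_table c e j a \<sigma> q) \<and>
     (\<forall>a<Suc L. \<forall>\<sigma><m. rmem s ''Z'' [c, a, \<sigma>] = cond_table c a \<sigma>) \<and>
     (\<forall>j. rmem s ''B'' [c, j] = count_table c j) \<and>
     (\<forall>k\<le>c. rmem s ''R'' [k] = real k) \<and> rmem s ''out'' [] = 0 \<and>
     (\<forall>k>c. \<forall>js. rmem s ''D'' (k # js) = 0 \<and> rmem s ''Z'' (k # js) = 0 \<and>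
        rmem s ''B'' (k # js) = 0 \<and> rmem s ''R'' (k # js) = 0)"

text \<open>The target cell determines the two outermost counters, the new symbol and the new
  automaton state, so their sums collapse to one term.\<close>

lemma wildcard_incr_eq:
  assumes "c < L" "\<sigma> < m" "q < n" "inputs s"
    and P: "\<And>\<sigma> \<tau>. \<sigma> < m \<Longrightarrow> \<tau> < m \<Longrightarrow> rmem s ''P'' [\<sigma>, \<tau>] = step_prob c \<sigma> \<tau>"
    and D: "\<And>e j a \<sigma> q. \<sigma> < m \<Longrightarrow> q < n \<Longrightarrow> rmem s ''D'' [c, e, j, a, \<sigma>, q] = vec_table c e j a \<sigma> q"
  shows "wildcard_incr s c [Suc c, e', j', a', \<sigma>, q] =
    (\<Sum>e<2. \<Sum>j<Suc L. \<Sum>a<Suc L. \<Sum>\<tau><m. \<Sum>q'<n.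
      if e' = e + (if i = Suc c then 1 else 0) \<and> j' = Suc j \<and> a' = a
      then vec_table c e j a \<tau> q' * (step_prob c \<tau> \<sigma> * wa_mat A \<sigma> $$ (q', q)) else 0)"
proof -
  have A: "rmem s ''A'' [\<sigma>, q', q] = wa_mat A \<sigma> $$ (q', q)" if "q' < n" for q'
    using assms that by (simp add: inputs_def)
  have "wildcard_incr s c [Suc c, e', j', a', \<sigma>, q] =
      (\<Sum>e<2. \<Sum>j<Suc L. \<Sum>a<Suc L. \<Sum>\<tau><m. \<Sum>q'<n.
        if e' = e + (if i = Suc c then 1 else 0) \<and> j' = Suc j \<and> a' = a
        then rmem s ''D'' [c, e, j, a, \<tau>, q'] * (rmem s ''P'' [\<tau>, \<sigma>] * rmem s ''A'' [\<sigma>, q', q]) else 0)"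
    unfolding wildcard_incr_def
    by (subst sum_pick[OF assms(2)], simp, subst sum_pick[OF assms(3)], simp)
      (simp del: sum.lessThan_Suc)
  also have "\<dots> = (\<Sum>e<2. \<Sum>j<Suc L. \<Sum>a<Suc L. \<Sum>\<tau><m. \<Sum>q'<n.
      if e' = e + (if i = Suc c then 1 else 0) \<and> j' = Suc j \<and> a' = a
      then vec_table c e j a \<tau> q' * (step_prob c \<tau> \<sigma> * wa_mat A \<sigma> $$ (q', q)) else 0)"
    by (intro sum.cong refl if_cong) (simp add: A P D assms(2))
  finally show ?thesis .
qed

lemma fixed_incr_eq:
  assumes "c < L" "\<sigma> < m" "q < n" "inputs s"
    and P: "\<And>\<sigma> \<tau>. \<sigma> < m \<Longrightarrow> \<tau> < m \<Longrightarrow> rmem s ''P'' [\<sigma>, \<tau>] = step_prob c \<sigma> \<tau>"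
    and D: "\<And>e j a \<sigma> q. \<sigma> < m \<Longrightarrow> q < n \<Longrightarrow> rmem s ''D'' [c, e, j, a, \<sigma>, q] = vec_table c e j a \<sigma> q"
    and Z: "\<And>a \<sigma>. a < Suc L \<Longrightarrow> \<sigma> < m \<Longrightarrow>
      rmem s ''Z'' [Suc c, a, \<sigma>] = (\<Sum>\<tau><m. cond_table c a \<tau> * step_prob c \<tau> \<sigma>)"
  shows "fixed_incr s c [Suc c, e', j', a', \<sigma>, q] =
    (\<Sum>e<2. \<Sum>j<Suc L. \<Sum>a<Suc L. \<Sum>\<tau><m. \<Sum>q'<n.
      if e' = e \<and> j' = j \<and> a' = Suc c \<and> \<sigma> = w ! c
      then vec_table c e j a \<tau> q' * (step_prob c \<tau> \<sigma> * wa_mat A \<sigma> $$ (q', q) /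
        (\<Sum>\<tau><m. cond_table c a \<tau> * step_prob c \<tau> \<sigma>)) else 0)"
proof -
  have A: "rmem s ''A'' [\<sigma>, q', q] = wa_mat A \<sigma> $$ (q', q)"
    if "\<sigma> < m" "q' < n" for \<sigma> q'
    using assms that by (simp add: inputs_def)
  have "fixed_incr s c [Suc c, e', j', a', \<sigma>, q] =
      (\<Sum>e<2. \<Sum>j<Suc L. \<Sum>a<Suc L. \<Sum>\<tau><m. \<Sum>q'<n.
        if e' = e \<and> j' = j \<and> a' = Suc c \<and> \<sigma> = w ! c
        then rmem s ''D'' [c, e, j, a, \<tau>, q'] * (rmem s ''P'' [\<tau>, w ! c] *
          rmem s ''A'' [w ! c, q', q] / rmem s ''Z'' [Suc c, a, w ! c]) else 0)"
    unfolding fixed_incr_def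
    by (subst sum_pick[OF assms(3)], simp) (simp del: sum.lessThan_Suc)
  also have "\<dots> = (\<Sum>e<2. \<Sum>j<Suc L. \<Sum>a<Suc L. \<Sum>\<tau><m. \<Sum>q'<n.
      if e' = e \<and> j' = j \<and> a' = Suc c \<and> \<sigma> = w ! c
      then vec_table c e j a \<tau> q' * (step_prob c \<tau> \<sigma> * wa_mat A \<sigma> $$ (q', q) /
        (\<Sum>\<tau><m. cond_table c a \<tau> * step_prob c \<tau> \<sigma>)) else 0)"
    by (intro sum.cong refl if_cong) (use assms(2) in \<open>auto simp: A P D Z\<close>)
  finally show ?thesis .
qed

section \<open>One position, initialisation, output and the whole run\<close>

lemma position_step_exec:
  assumes s: "progress c s" "nmem s ''c'' [] = c" and c: "c < L"
    and mach: "computes_markov m P mach T"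
  shows "\<exists>t s'. exec (machine_proc mach) position_step s t s' \<and>
    t \<le> 7 * step_time + 10 + T (Suc c) \<and> nmem s' ''c'' [] = c \<and> progress (Suc c) s'"
proof -
  let ?proc = "machine_proc mach"
  note prog = s(1)[unfolded progress_def]
  have frame: "inputs s2 \<and> nmem s2 ''c'' [] = c"
    if "inputs s1" "nmem s1 ''c'' [] = c" "same_nmem counters s1 s2" "rmem s2 = (rmem s1)(y := Y)"
      "y \<notin> {''A'', ''beta''}" for s1 s2 y Y
    using that inputs_adding[OF that(1,3,4,5)] by (auto simp: same_nmem_def counters_def)
  have wc: "w ! c < m" using c by (rule w_less)
  have in0: "inputs s" using prog by simp
  obtain t1 s1 where s1: "exec ?proc add_cond s t1 s1" "t1 \<le> step_time" "same_nmem counters s s1"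
    "rmem s1 = (rmem s)(''Z'' := (\<lambda>js. rmem s ''Z'' js + (\<Sum>a<Suc L. \<Sum>\<tau><m. \<Sum>\<sigma><m.
      if js = [Suc c, a, \<tau>] then rmem s ''Z'' [c, a, \<sigma>] * rmem s ''P'' [\<sigma>, \<tau>] else 0)))"
    using adding_cond[OF in0 s(2)] unfolding adding_def by blast
  have in1: "inputs s1" "nmem s1 ''c'' [] = c" using frame[OF in0 s(2) s1(3,4)] by simp_all
  obtain t2 s2 where s2: "exec ?proc add_wildcard s1 t2 s2" "t2 \<le> step_time" "same_nmem counters s1 s2"
    "rmem s2 = (rmem s1)(''D'' := (\<lambda>js. rmem s1 ''D'' js + wildcard_incr s1 c js))"
    using adding_wildcard[OF in1] unfolding adding_def by blast
  have in2: "inputs s2" "nmem s2 ''c'' [] = c" using frame[OF in1 s2(3,4)] by simp_all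
  obtain t3 s3 where s3: "exec ?proc add_fixed s2 t3 s3" "t3 \<le> step_time" "same_nmem counters s2 s3"
    "rmem s3 = (rmem s2)(''D'' := (\<lambda>js. rmem s2 ''D'' js + fixed_incr s2 c js))"
    using adding_fixed[OF in2 c] unfolding adding_def by blast
  have in3: "inputs s3" "nmem s3 ''c'' [] = c" using frame[OF in2 s3(3,4)] by simp_all
  have "adding ?proc (add_cell ''Z'' [nsucc ''c'', nsucc ''c'', cur_symbol] (RConst 1)) s3 ''Z''
      (\<lambda>js. if js = [Suc c, Suc c, w ! c] then 1 else 0)"
    using in3 c by (intro adding_cell) (auto simp: inputs_def)
  then obtain t4 s4 where s4:
    "exec ?proc (add_cell ''Z'' [nsucc ''c'', nsucc ''c'', cur_symbol] (RConst 1)) s3 t4 s4"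
    "t4 \<le> step_time" "same_nmem counters s3 s4"
    "rmem s4 = (rmem s3)(''Z'' := (\<lambda>js. rmem s3 ''Z'' js + (if js = [Suc c, Suc c, w ! c] then 1 else 0)))"
    unfolding adding_def by blast
  have in4: "inputs s4" "nmem s4 ''c'' [] = c" using frame[OF in3 s4(3,4)] by simp_all
  obtain t5 s5 where s5: "exec ?proc (add_count (nvar ''j'')) s4 t5 s5" "t5 \<le> step_time"
    "same_nmem counters s4 s5" "rmem s5 = (rmem s4)(''B'' := (\<lambda>js. rmem s4 ''B'' js +
       (\<Sum>j<Suc L. if js = [Suc c, j] then rmem s4 ''B'' [c, j] else 0)))"
    using adding_count(1)[OF in4] unfolding adding_def by blast
  have in5: "inputs s5" "nmem s5 ''c'' [] = c" using frame[OF in4 s5(3,4)] by simp_all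
  obtain t6 s6 where s6: "exec ?proc (add_count (nsucc ''j'')) s5 t6 s6" "t6 \<le> step_time"
    "same_nmem counters s5 s6" "rmem s6 = (rmem s5)(''B'' := (\<lambda>js. rmem s5 ''B'' js +
       (\<Sum>j<Suc L. if js = [Suc c, Suc j] then rmem s5 ''B'' [c, j] else 0)))"
    using adding_count(2)[OF in5] unfolding adding_def by blast
  have in6: "inputs s6" "nmem s6 ''c'' [] = c" using frame[OF in5 s6(3,4)] by simp_all
  have "adding ?proc (add_cell ''R'' [nsucc ''c''] (RAdd (RCell ''R'' [nvar ''c'']) (RConst 1))) s6 ''R''
      (\<lambda>js. if js = [Suc c] then rmem s6 ''R'' [c] + 1 else 0)"
    using in6 by (intro adding_cell) (auto simp: agree_def same_nmem_def)
  then obtain t7 s7 where s7: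
    "exec ?proc (add_cell ''R'' [nsucc ''c''] (RAdd (RCell ''R'' [nvar ''c'']) (RConst 1))) s6 t7 s7"
    "t7 \<le> step_time" "same_nmem counters s6 s7" "rmem s7 = (rmem s6)(''R'' := (\<lambda>js. rmem s6 ''R'' js +
       (if js = [Suc c] then rmem s6 ''R'' [c] + 1 else 0)))"
    unfolding adding_def by blast
  have in7: "inputs s7" "nmem s7 ''c'' [] = c" using frame[OF in6 s7(3,4)] by simp_all
  \<comment> \<open>The procedure is specified for arguments from 1 on, and the argument here is
    \<open>Suc c\<close>; the transition out of position 0 was the initial distribution.\<close>
  obtain t8 a where a: "?proc (Suc c) t8 a" "t8 \<le> T (Suc c)"
    "\<And>\<sigma> \<tau>. \<sigma> < m \<Longrightarrow> \<tau> < m \<Longrightarrow> a [\<sigma>, \<tau>] = mk_trans P (Suc c) \<sigma> \<tau>"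
    using mach unfolding computes_markov_def by (metis le_add1 plus_1_eq_Suc)
  let ?s8 = "s7\<lparr>rmem := (rmem s7)(''P'' := a)\<rparr>"
  have call: "exec ?proc (Call ''P'' (nsucc ''c'')) s7 (1 + ncost (nsucc ''c'') + t8) ?s8"
    using in7 a(1) by (intro exec.Call) simp
  have run: "exec ?proc position_step s
      (t1 + (t2 + (t3 + (t4 + (t5 + (t6 + (t7 + (1 + ncost (nsucc ''c'') + t8)))))))) ?s8"
    unfolding position_step_def
    by (intro exec.Seq[OF s1(1)] exec.Seq[OF s2(1)] exec.Seq[OF s3(1)] exec.Seq[OF s4(1)]
      exec.Seq[OF s5(1)] exec.Seq[OF s6(1)] exec.Seq[OF s7(1)] call)
  \<comment> \<open>The new layer of \<open>Z\<close> before its point mass, for every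
    \<open>a\<close> in range: exactly the divisors needed by the fixed step.\<close>
  have Z1: "rmem s1 ''Z'' [Suc c, a, \<sigma>] = (\<Sum>\<tau><m. cond_table c a \<tau> * step_prob c \<tau> \<sigma>)"
    if "a < Suc L" "\<sigma> < m" for a \<sigma>
  proof -
    have "(\<Sum>a'<Suc L. \<Sum>\<tau><m. \<Sum>\<sigma>'<m. if [Suc c, a, \<sigma>] = [Suc c, a', \<tau>]
        then rmem s ''Z'' [c, a', \<sigma>'] * rmem s ''P'' [\<sigma>', \<tau>] else 0) =
        (\<Sum>\<sigma>'<m. rmem s ''Z'' [c, a, \<sigma>'] * rmem s ''P'' [\<sigma>', \<sigma>])"
      by (subst sum_pick[OF that(1)], force, subst sum_pick[OF that(2)], force, simp)
    also have "\<dots> = (\<Sum>\<tau><m. cond_table c a \<tau> * step_prob c \<tau> \<sigma>)"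
      using prog that by (intro sum.cong) simp_all
    finally show ?thesis using prog unfolding s1(4) by simp
  qed
  have D3: "rmem s3 ''D'' [Suc c, e, j, a, \<sigma>, q] = vec_table (Suc c) e j a \<sigma> q"
    if "\<sigma> < m" "q < n" for e j a \<sigma> q
  proof -
    have P: "rmem s1 ''P'' = rmem s ''P''" "rmem s2 ''P'' = rmem s ''P''" by (simp_all add: s1(4) s2(4))
    \<comment> \<open>The wildcard step writes only to layer \<open>Suc c\<close>, so the fixed step
      still reads the old table.\<close>
    have "wildcard_incr s1 c (c # js) = 0" for js
      by (simp add: wildcard_incr_def)
    then have D: "rmem s1 ''D'' = rmem s ''D''" "rmem s2 ''D'' (c # js) = rmem s ''D'' (c # js)" for js
      by (simp_all add: s1(4) s2(4))
    have w: "wildcard_incr s1 c [Suc c, e, j, a, \<sigma>, q] =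
      (\<Sum>e'<2. \<Sum>j'<Suc L. \<Sum>a'<Suc L. \<Sum>\<tau><m. \<Sum>q'<n.
        if e = e' + (if i = Suc c then 1 else 0) \<and> j = Suc j' \<and> a = a'
        then vec_table c e' j' a' \<tau> q' * (step_prob c \<tau> \<sigma> * wa_mat A \<sigma> $$ (q', q)) else 0)"
      using prog by (intro wildcard_incr_eq[OF c that in1(1)]) (simp_all add: P D)
    have Z: "rmem s2 ''Z'' = rmem s1 ''Z''" by (simp add: s2(4))
    have f: "fixed_incr s2 c [Suc c, e, j, a, \<sigma>, q] =
      (\<Sum>e'<2. \<Sum>j'<Suc L. \<Sum>a'<Suc L. \<Sum>\<tau><m. \<Sum>q'<n.
        if e = e' \<and> j = j' \<and> a = Suc c \<and> \<sigma> = w ! c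
        then vec_table c e' j' a' \<tau> q' * (step_prob c \<tau> \<sigma> * wa_mat A \<sigma> $$ (q', q) /
          (\<Sum>\<tau><m. cond_table c a' \<tau> * step_prob c \<tau> \<sigma>)) else 0)"
      using prog by (intro fixed_incr_eq[OF c that in2(1)]) (simp_all add: P D Z Z1 del: sum.lessThan_Suc)
    have "rmem s ''D'' [Suc c, e, j, a, \<sigma>, q] = 0" using prog by simp
    then have "rmem s3 ''D'' [Suc c, e, j, a, \<sigma>, q] =
        wildcard_incr s1 c [Suc c, e, j, a, \<sigma>, q] + fixed_incr s2 c [Suc c, e, j, a, \<sigma>, q]"
      by (simp add: s3(4) s2(4) D)
    then show ?thesis unfolding w f vec_table_Suc[OF c that] .
  qed
  have D0: "rmem s3 ''D'' (k # js) = 0" if "k > Suc c" for k js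
  proof -
    have "wildcard_incr s1 c (k # js) = 0" "fixed_incr s2 c (k # js) = 0"
      using that by (auto simp: wildcard_incr_def fixed_incr_def intro!: sum.neutral)
    then show ?thesis using prog that by (simp add: s3(4) s2(4) s1(4))
  qed
  have "progress (Suc c) ?s8"
    unfolding progress_def
  proof (intro conjI allI impI)
    show "inputs ?s8" using in7(1) by (simp add: inputs_def)
  next
    fix \<sigma> \<tau> assume "\<sigma> < m" "\<tau> < m"
    then show "rmem ?s8 ''P'' [\<sigma>, \<tau>] = step_prob (Suc c) \<sigma> \<tau>" by (simp add: a(3) step_prob_def)
  next
    fix e j a \<sigma> q assume "\<sigma> < m" "q < n"
    then show "rmem ?s8 ''D'' [Suc c, e, j, a, \<sigma>, q] = vec_table (Suc c) e j a \<sigma> q"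
      using D3 by (simp add: s7(4) s6(4) s5(4) s4(4))
  next
    fix a \<sigma> assume "a < Suc L" "\<sigma> < m"
    then show "rmem ?s8 ''Z'' [Suc c, a, \<sigma>] = cond_table (Suc c) a \<sigma>"
      using Z1[of a \<sigma>] by (simp add: s7(4) s6(4) s5(4) s4(4) s3(4) s2(4))
  next
    fix j
    have B: "rmem s4 ''B'' = rmem s ''B''" by (simp add: s4(4) s3(4) s2(4) s1(4))
    have "rmem ?s8 ''B'' [Suc c, j] =
        (\<Sum>j'<Suc L. if j = j' then count_table c j' else 0) +
        (\<Sum>j'<Suc L. if j = Suc j' then count_table c j' else 0)"
      using prog by (simp add: s7(4) s6(4) s5(4) B del: sum.lessThan_Suc cong: if_cong)
    then show "rmem ?s8 ''B'' [Suc c, j] = count_table (Suc c) j"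
      by (simp only: count_table_Suc[OF c])
  next
    fix k assume "k \<le> Suc c"
    then show "rmem ?s8 ''R'' [k] = real k"
      using prog by (auto simp: s7(4) s6(4) s5(4) s4(4) s3(4) s2(4) s1(4) le_Suc_eq)
  next
    show "rmem ?s8 ''out'' [] = 0" using prog by (simp add: s7(4) s6(4) s5(4) s4(4) s3(4) s2(4) s1(4))
  next
    fix k js assume k: "k > Suc c"
    show "rmem ?s8 ''D'' (k # js) = 0" using D0[OF k] by (simp add: s7(4) s6(4) s5(4) s4(4))
    show "rmem ?s8 ''Z'' (k # js) = 0" "rmem ?s8 ''B'' (k # js) = 0" "rmem ?s8 ''R'' (k # js) = 0"
      using prog k by (simp_all add: s7(4) s6(4) s5(4) s4(4) s3(4) s2(4) s1(4))
  qed
  \<comment> \<open>Seven pieces cost at most \<open>step_time\<close> each; the call costs 4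
    besides the time of the procedure.\<close>
  moreover have "t1 + (t2 + (t3 + (t4 + (t5 + (t6 + (t7 + (1 + ncost (nsucc ''c'') + t8)))))))
      \<le> 7 * step_time + 10 + T (Suc c)"
    using s1(2) s2(2) s3(2) s4(2) s5(2) s6(2) s7(2) a(2) by simp
  ultimately show ?thesis using run in7(2) by (intro exI conjI) auto
qed

lemma init_exec:
  "\<exists>t s'. exec proc init_tables (shap_input m A w i P) t s' \<and>
     t \<le> 4 * step_time \<and> progress 0 s'"
proof -
  let ?s = "shap_input m A w i P"
  have in0: "inputs ?s" by (simp add: inputs_def shap_input_def arr0_def arr1_def arr3_def)
  then have m: "nmem ?s ''alphabet'' [] = m" by (simp add: inputs_def)
  obtain t1 s1 where s1: "exec proc add_trans ?s t1 s1" "t1 \<le> step_time" "same_nmem counters ?s s1"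
    "rmem s1 = (rmem ?s)(''P'' := (\<lambda>js. rmem ?s ''P'' js +
       (\<Sum>\<sigma><m. \<Sum>\<tau><m. if js = [\<sigma>, \<tau>] then rmem ?s ''init'' [\<tau>] else 0)))"
    using adding_trans[OF m] unfolding adding_def by blast
  have in1: "inputs s1" using inputs_adding[OF in0 s1(3,4)] by simp
  then have n: "nmem s1 ''size'' [] = n" by (simp add: inputs_def)
  obtain t2 s2 where s2: "exec proc add_alpha s1 t2 s2" "t2 \<le> step_time" "same_nmem counters s1 s2"
    "rmem s2 = (rmem s1)(''D'' := (\<lambda>js. rmem s1 ''D'' js +
       (\<Sum>q<n. if js = [0, 0, 0, 0, 0, q] then rmem s1 ''alpha'' [q] else 0)))"
    using adding_alpha[OF n] unfolding adding_def by blast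
  have in2: "inputs s2" using inputs_adding[OF in1 s2(3,4)] by simp
  have "adding proc (add_cell ''Z'' [NConst 0, NConst 0, NConst 0] (RConst 1)) s2 ''Z''
      (\<lambda>js. if js = [0, 0, 0] then 1 else 0)"
    by (intro adding_cell) auto
  then obtain t3 s3 where s3:
    "exec proc (add_cell ''Z'' [NConst 0, NConst 0, NConst 0] (RConst 1)) s2 t3 s3" "t3 \<le> step_time"
    "same_nmem counters s2 s3"
    "rmem s3 = (rmem s2)(''Z'' := (\<lambda>js. rmem s2 ''Z'' js + (if js = [0, 0, 0] then 1 else 0)))"
    unfolding adding_def by blast
  have in3: "inputs s3" using inputs_adding[OF in2 s3(3,4)] by simp
  have "adding proc (add_cell ''B'' [NConst 0, NConst 0] (RConst 1)) s3 ''B''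
      (\<lambda>js. if js = [0, 0] then 1 else 0)"
    by (intro adding_cell) auto
  then obtain t4 s4 where s4:
    "exec proc (add_cell ''B'' [NConst 0, NConst 0] (RConst 1)) s3 t4 s4" "t4 \<le> step_time"
    "same_nmem counters s3 s4"
    "rmem s4 = (rmem s3)(''B'' := (\<lambda>js. rmem s3 ''B'' js + (if js = [0, 0] then 1 else 0)))"
    unfolding adding_def by blast
  have in4: "inputs s4" using inputs_adding[OF in3 s4(3,4)] by simp
  have zero: "rmem ?s y js = 0" if "y \<notin> {''alpha'', ''A'', ''beta'', ''init''}" for y js
    using that by (simp add: shap_input_def)
  have "progress 0 s4"
    unfolding progress_def
  proof (intro conjI allI impI)
    fix \<sigma> \<tau> assume st: "\<sigma> < m" "\<tau> < m"
    have "(\<Sum>\<sigma>'<m. \<Sum>\<tau>'<m. if [\<sigma>, \<tau>] = [\<sigma>', \<tau>'] then rmem ?s ''init'' [\<tau>'] else 0) = rmem ?s ''init'' [\<tau>]"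
      by (subst sum_pick[OF st(1)], simp, subst sum_pick[OF st(2)], simp) simp
    then show "rmem s4 ''P'' [\<sigma>, \<tau>] = step_prob 0 \<sigma> \<tau>"
      using st by (simp add: s4(4) s3(4) s2(4) s1(4) zero)
        (simp add: shap_input_def arr1_def step_prob_def)
  next
    fix e j a \<sigma> q assume q: "\<sigma> < m" "q < n"
    from q show "rmem s4 ''D'' [0, e, j, a, \<sigma>, q] = vec_table 0 e j a \<sigma> q"
      by (simp add: s4(4) s3(4) s2(4) s1(4) zero vec_table_0)
        (simp add: shap_input_def arr1_def)
  qed (use in4 in \<open>auto simp: s4(4) s3(4) s2(4) s1(4) zero count_table_0\<close>)
  moreover have "exec proc init_tables ?s (t1 + (t2 + (t3 + t4))) s4"
    unfolding init_tables_def
    by (intro exec.Seq[OF s1(1)] exec.Seq[OF s2(1)] exec.Seq[OF s3(1)] s4(1))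
  moreover have "t1 + (t2 + (t3 + t4)) \<le> 4 * step_time" using s1(2) s2(2) s3(2) s4(2) by simp
  ultimately show ?thesis by blast
qed

lemma out_exec:
  assumes "progress L s"
  shows "\<exists>t s'. exec proc add_out s t s' \<and> t \<le> step_time \<and>
    rmem s' ''out'' [] = shap {..<m} (wa_lang A) w i P"
proof -
  note prog = assms[unfolded progress_def]
  then have "inputs s" by simp
  from adding_out[OF this, of proc] obtain t s' where s': "exec proc add_out s t s'" "t \<le> step_time"
    "rmem s' = (rmem s)(''out'' := (\<lambda>js. rmem s ''out'' js + (\<Sum>j<L - 1. \<Sum>\<sigma><m. \<Sum>q<n. \<Sum>a<Suc L.
    if js = [] then (rmem s ''D'' [L, 0, Suc j, a, \<sigma>, q] - rmem s ''D'' [L, 1, Suc (Suc j), a, \<sigma>, q]) *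
      rmem s ''beta'' [q] / (rmem s ''R'' [Suc j] * rmem s ''B'' [L, Suc j]) else 0)))"
    unfolding adding_def by blast
  have "rmem s' ''out'' [] = (\<Sum>j<L - 1. \<Sum>\<sigma><m. \<Sum>q<n. \<Sum>a<Suc L.
    (rmem s ''D'' [L, 0, Suc j, a, \<sigma>, q] - rmem s ''D'' [L, 1, Suc (Suc j), a, \<sigma>, q]) *
      rmem s ''beta'' [q] / (rmem s ''R'' [Suc j] * rmem s ''B'' [L, Suc j]))"
    using prog by (simp add: s'(3) del: sum.lessThan_Suc)
  also have "\<dots> = shap {..<m} (wa_lang A) w i P"
    unfolding shap_eq using prog by (intro sum.cong refl) (simp add: inputs_def)
  finally show ?thesis using s'(1,2) by blast
qed

lemma shap_prog_exec:
  assumes mach: "computes_markov m P mach (\<lambda>k. c * (k + m) ^ d)"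
  shows "\<exists>t s. exec (machine_proc mach) shap_prog (shap_input m A w i P) t s \<and>
    rmem s ''out'' [] = shap {..<m} (wa_lang A) w i P \<and>
    t \<le> 5 * step_time + 13 * bd * (7 * step_time + 10 + c * bd ^ d)"
proof -
  let ?proc = "machine_proc mach" and ?T = "7 * step_time + 10 + c * bd ^ d"
  obtain t1 s1 where s1: "exec ?proc init_tables (shap_input m A w i P) t1 s1"
    "t1 \<le> 4 * step_time" "progress 0 s1"
    using init_exec by blast
  have "\<exists>t s'. exec ?proc (for_loop ''c'' (nvar ''length'') position_step) s1 t s' \<and>
      t \<le> 13 * bd * ?T \<and> progress L s'"
  proof (rule for_loop_exec[where I = progress])
    fix k s assume k: "k < L" "progress k s" "nmem s ''c'' [] = k"
    \<comment> \<open>All calls have an argument of at most \<open>L\<close>, so one bound in terms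
      of \<open>bd\<close> serves every round.\<close>
    have le: "c * (Suc k + m) ^ d \<le> c * bd ^ d"
      using k(1) by (intro mult_le_mono2 power_mono) (simp_all add: bd_def)
    obtain t s' where s': "exec ?proc position_step s t s'"
      "t \<le> 7 * step_time + 10 + c * (Suc k + m) ^ d" "nmem s' ''c'' [] = k" "progress (Suc k) s'"
      using position_step_exec[OF k(2,3,1) mach] by blast
    have "t \<le> ?T" using s'(2) le by linarith
    with s' show "\<exists>t s'. exec ?proc position_step s t s' \<and> t \<le> ?T \<and> nmem s' ''c'' [] = k \<and>
        progress (Suc k) s'"
      by blast
  qed (use s1(3) in \<open>auto simp: progress_def inputs_def nupdate_def bd_def\<close>)
  then obtain t2 s2 where s2: "exec ?proc (for_loop ''c'' (nvar ''length'') position_step) s1 t2 s2"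
    "t2 \<le> 13 * bd * ?T" "progress L s2" by blast
  obtain t3 s3 where s3: "exec ?proc add_out s2 t3 s3" "t3 \<le> step_time"
    "rmem s3 ''out'' [] = shap {..<m} (wa_lang A) w i P"
    using out_exec[OF s2(3)] by blast
  have "exec ?proc shap_prog (shap_input m A w i P) (t1 + (t2 + t3)) s3"
    unfolding shap_prog_def by (intro exec.Seq[OF s1(1)] exec.Seq[OF s2(1)] s3(1))
  moreover have "t1 + (t2 + t3) \<le> 5 * step_time + 13 * bd * ?T"
    using s1(2) s2(2) s3(2) by simp
  ultimately show ?thesis using s3(3) by blast
qed

section \<open>The polynomial bound\<close>

lemma time_bound:
  "5 * step_time + 13 * bd * (7 * step_time + 10 + c * bd ^ d) \<le>
     (9600 * 13 ^ 7 + 130 + 13 * c) * 2 ^ (8 + d) * (n + L + m) ^ (8 + d)"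
proof -
  let ?S = "n + L + m" and ?D = "8 + d"
  \<comment> \<open>Word and alphabet are nonempty, so the additive 2 in \<open>bd\<close> is
    absorbed by doubling; this is the origin of the factor \<open>2 ^ (8 + d)\<close>.\<close>
  have "2 \<le> ?S" using i m_pos by simp
  then have "bd \<le> 2 * ?S" by (simp add: bd_def)
  then have S: "bd ^ ?D \<le> 2 ^ ?D * ?S ^ ?D"
    by (metis power_mono power_mult_distrib zero_le)
  have bd1: "1 \<le> bd" by (simp add: bd_def)
  have pow: "bd ^ k \<le> bd ^ ?D" if "k \<le> ?D" for k
    using that bd1 by (intro power_increasing) simp_all
  have st: "step_time = 100 * 13 ^ 7 * bd ^ 7"
    by (simp add: step_time_def power_mult_distrib)
  \<comment> \<open>Here 500 = 5 * 100 and 9100 = 13 * 7 * 100, which add up to 9600, and 130 = 13 *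
    10. All powers of \<open>bd\<close> are then raised to \<open>8 + d\<close>, which exceeds both
    8 and \<open>d + 1\<close>.\<close>
  have "5 * step_time + 13 * bd * (7 * step_time + 10 + c * bd ^ d) =
      500 * 13 ^ 7 * bd ^ 7 + 9100 * 13 ^ 7 * bd ^ 8 + 130 * bd ^ 1 + 13 * c * bd ^ (d + 1)"
    by (simp add: st algebra_simps power_numeral_reduce)
  also have "\<dots> \<le> 500 * 13 ^ 7 * bd ^ ?D + 9100 * 13 ^ 7 * bd ^ ?D + 130 * bd ^ ?D + 13 * c * bd ^ ?D"
    using pow[of 7] pow[of 8] pow[of 1] pow[of "d + 1"] by (intro add_mono mult_le_mono2) simp_all
  also have "\<dots> = (9600 * 13 ^ 7 + 130 + 13 * c) * bd ^ ?D"
    by (simp add: algebra_simps)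
  also have "\<dots> \<le> (9600 * 13 ^ 7 + 130 + 13 * c) * (2 ^ ?D * ?S ^ ?D)"
    by (rule mult_le_mono2[OF S])
  finally show ?thesis by (simp only: mult.assoc)
qed

end

theorem theorem3p1:
  shows "\<exists>alg. real_consts alg \<subseteq> \<rat> \<and>
    (\<forall>c d. \<exists>C D. \<forall>m A w i P mach.
       weighted_automaton {..<m} A \<and> set w \<subseteq> {..<m} \<and> 1 \<le> i \<and> i \<le> length w \<and>
       markovian {..<m} P \<and> computes_markov m P mach (\<lambda>n. c * (n + m) ^ d) \<longrightarrow>
       (\<exists>t s. exec (machine_proc mach) alg (shap_input m A w i P) t s \<and>
              rmem s ''out'' [] = shap {..<m} (wa_lang A) w i P \<and>
              t \<le> C * (wa_size A + length w + m) ^ D))"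
proof (intro exI[of _ shap_prog] conjI allI real_consts_shap_prog)
  fix c d :: nat
  show "\<exists>C D. \<forall>m A w i P mach.
       weighted_automaton {..<m} A \<and> set w \<subseteq> {..<m} \<and> 1 \<le> i \<and> i \<le> length w \<and>
       markovian {..<m} P \<and> computes_markov m P mach (\<lambda>n. c * (n + m) ^ d) \<longrightarrow>
       (\<exists>t s. exec (machine_proc mach) shap_prog (shap_input m A w i P) t s \<and>
              rmem s ''out'' [] = shap {..<m} (wa_lang A) w i P \<and>
              t \<le> C * (wa_size A + length w + m) ^ D)"
  \<comment> \<open>Both witnesses depend only on the exponent and the factor in the time bound of
    the given machines, not on the instance.\<close>
  proof (rule exI[of _ "(9600 * 13 ^ 7 + 130 + 13 * c) * 2 ^ (8 + d)"], rule exI[of _ "8 + d"],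
      intro allI impI)
    fix m A w i P mach
    assume *: "weighted_automaton {..<m} A \<and> set w \<subseteq> {..<m} \<and> 1 \<le> i \<and> i \<le> length w \<and>
       markovian {..<m} P \<and> computes_markov m P mach (\<lambda>n. c * (n + m) ^ d)"
    then interpret shap_instance m A w i P by unfold_locales simp_all
    show "\<exists>t s. exec (machine_proc mach) shap_prog (shap_input m A w i P) t s \<and>
        rmem s ''out'' [] = shap {..<m} (wa_lang A) w i P \<and>
        t \<le> (9600 * 13 ^ 7 + 130 + 13 * c) * 2 ^ (8 + d) * (wa_size A + length w + m) ^ (8 + d)"
      using shap_prog_exec[of mach c d] time_bound[of c d] * by (meson le_trans)
  qed
qed

end
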